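(* Let $\mathbf{P}$ be a fixed $a\times b$ matrix of rank $r$ with non-negative entries and with no identically zero row or column, let $\mathbf{B}$ be its $m\times n$ blown up matrix, assumed irreducible, let $\mathbf{W}$ be an $m\times n$ Wigner-noise and $\mathbf{A}=\mathbf{B}+\mathbf{W}$. Assume the growth conditions GC1 and GC2. Let $0<\tau<1/2$ be arbitrary, $\epsilon=\max\{n^{-\tau},m^{-\tau}\}$, and let $\delta>0$ be the constant (independent of $m,n,\tau$) specified in the context. Let $\mathbf{y}_1,\dots,\mathbf{y}_r\in\mathbb{R}^m$ and $\mathbf{x}_1,\dots,\mathbf{x}_r\in\mathbb{R}^n$ be orthonormal systems of left- and right-hand side singular vectors of $\mathbf{A}_{corr}$ corresponding to its $r$ largest singular values, and let $\mathbf{Y}_{corr}$ and $\mathbf{X}_{corr}$ be the $m\times r$ and $n\times r$ matrices with columns $\mathbf{D}_{Arow}^{-1/2}\mathbf{y}_i$ and $\mathbf{D}_{Acol}^{-1/2}\mathbf{x}_i$ ($i=1,\dots,r$), respectively. Then $$S_a^2(\mathbf{Y}_{corr})\le\frac{r}{\left(\frac{\delta}{\epsilon}-1\right)^2}\qquad\text{and}\qquad S_b^2(\mathbf{X}_{corr})\le\frac{r}{\left(\frac{\delta}{\epsilon}-1\right)^2}$$ hold almost surely.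
   Context: Wigner-noise: an $m\times n$ real random matrix $\mathbf{W}$ with independent entries $w_{ij}$, $\mathbb{E}(w_{ij})=0$, uniformly bounded: $|w_{ij}|\le K$ for all $i,j$, with a constant $K>0$ independent of $m$ and $n$. Blown up matrix: given the $a\times b$ pattern matrix $\mathbf{P}=(p_{ij})$ and positive integers $m_1,\dots,m_a$ with $\sum_i m_i=m$ and $n_1,\dots,n_b$ with $\sum_j n_j=n$, the blown up matrix $\mathbf{B}$ is the $m\times n$ matrix divided into $a\times b$ blocks, where block $(i,j)$ is an $m_i\times n_j$ matrix with all entries equal to $p_{ij}$. The pattern $\mathbf{P}$ is fixed, while $m,n$ and the block sizes vary. $\mathbf{B}$ is irreducible if it cannot be brought to a block-diagonal form with more than one block by permuting rows and columns. GC1: there are constants $0<c<1$ and $0<d<1$, independent of $m,n$, such that $m_i/m\ge c$ for $i=1,\dots,a$ and $n_j/n\ge d$ for $j=1,\dots,b$. GC2: there are constants $C\ge1$, $D\ge1$, $C_0>0$, $D_0>0$ such that $m\le C_0 n^C$ and $n\le D_0 m^D$ hold for sufficiently large $m$ and $n$. Correspondence transformation: for $\mathbf{A}=(a_{ij})$ put $d_{Arow\,i}=\sum_j a_{ij}$, $d_{Acol\,j}=\sum_i a_{ij}$, $\mathbf{D}_{Arow}=\mathrm{diag}(d_{Arow\,1},\dots,d_{Arow\,m})$, $\mathbf{D}_{Acol}=\mathrm{diag}(d_{Acol\,1},\dots,d_{Acol\,n})$ and $\mathbf{A}_{corr}=\mathbf{D}_{Arow}^{-1/2}\mathbf{A}\mathbf{D}_{Acol}^{-1/2}$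 (almost surely the row and column sums are positive for large $m,n$). Singular vectors are paired: $\mathbf{A}_{corr}\mathbf{x}_i=z_i\mathbf{y}_i$ where $z_1,\dots,z_r$ are the $r$ largest singular values of $\mathbf{A}_{corr}$. The constant $\delta$: a positive number independent of $m,n$ such that for every $0<\tau<1/2$, almost surely, the $r$ largest singular values of $\mathbf{A}_{corr}$ lie in $[\delta-\max\{n^{-\tau},m^{-\tau}\},\,1+\max\{n^{-\tau},m^{-\tau}\}]$ and all the others are at most $\max\{n^{-\tau},m^{-\tau}\}$ (such a $\delta$ exists under GC1 and GC2). Weighted variances: let $\mathbf{y}^1_{corr},\dots,\mathbf{y}^m_{corr}\in\mathbb{R}^r$ be the rows of $\mathbf{Y}_{corr}$ and $\mathbf{x}^1_{corr},\dots,\mathbf{x}^n_{corr}\in\mathbb{R}^r$ the rows of $\mathbf{X}_{corr}$. Then $$S_a^2(\mathbf{Y}_{corr})=\min_{\{A'_1,\dots,A'_a\}}\sum_{i=1}^a\sum_{j\in A'_i}d_{Arow\,j}\|\mathbf{y}^j_{corr}-\bar{\mathbf{y}}^i_{corr}\|^2,\quad \bar{\mathbf{y}}^i_{corr}=\frac{\sum_{j\in A'_i}d_{Arow\,j}\,\mathbf{y}^j_{corr}}{\sum_{j\in A'_i}d_{Arow\,j}},$$ $$S_b^2(\mathbf{X}_{corr})=\min_{\{B'_1,\dots,B'_b\}}\sum_{i=1}^b\sum_{j\in B'_i}d_{Acol\,j}\|\mathbf{x}^j_{corr}-\bar{\mathbf{x}}^i_{corr}\|^2,\quad \bar{\mathbf{x}}^i_{corr}=\frac{\sum_{j\in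 B'_i}d_{Acol\,j}\,\mathbf{x}^j_{corr}}{\sum_{j\in B'_i}d_{Acol\,j}},$$ the minima being over all partitions of $\{1,\dots,m\}$ into $a$ parts and of $\{1,\dots,n\}$ into $b$ parts, respectively. Almost surely: a property $\mathcal{P}_{m,n}$ holds almost surely for the random matrices $\mathbf{A}_{m\times n}$ if $\mathbb{P}(\exists\, m_0,n_0\in\mathbb{N}$ such that for all $m\ge m_0$ and $n\ge n_0$, $\mathbf{A}_{m\times n}$ has $\mathcal{P}_{m,n})=1$, where $m,n$ and the block sizes grow subject to the stated growth conditions and $K$ is kept fixed. *)

theory Defs
  imports
    "HOL-Probability.Probability"
    "HOL-Library.Disjoint_Sets"
    "HOL-Combinatorics.Permutations"
    "Jordan_Normal_Form.Char_Poly"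
    "Jordan_Normal_Form.DL_Rank"
begin

text \<open>Rows, columns and blocks are numbered from 0. Block sizes are given by functions of the
  block number, of which only the values at actual block numbers matter.\<close>

subsection \<open>Blown up matrices\<close>

definition block_of :: "(nat \<Rightarrow> nat) \<Rightarrow> nat \<Rightarrow> nat" where
  "block_of sz k = (LEAST i. k < (\<Sum>i'\<le>i. sz i'))"

definition blow_up :: "real mat \<Rightarrow> (nat \<Rightarrow> nat) \<Rightarrow> (nat \<Rightarrow> nat) \<Rightarrow> nat \<Rightarrow> nat \<Rightarrow> real mat" where
  "blow_up P ms ns m n =
     Matrix.mat m n (\<lambda>(k, l). P $$ (block_of ms k, block_of ns l))"

text \<open>The diagonal blocks are required to have at least one row and one column: otherwise
  appending an empty block would make every matrix reducible.\<close>

definition irreducible_mat :: "real mat \<Rightarrow> bool" where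
  "irreducible_mat B \<longleftrightarrow>
     \<not> (\<exists>\<pi> \<sigma> Bs. \<pi> permutes {..<dim_row B} \<and> \<sigma> permutes {..<dim_col B} \<and>
          1 < length Bs \<and> (\<forall>X\<in>set Bs. 0 < dim_row X \<and> 0 < dim_col X) \<and>
          Matrix.mat (dim_row B) (dim_col B) (\<lambda>(i, j). B $$ (\<pi> i, \<sigma> j)) = diag_block_mat Bs)"

subsection \<open>Wigner-noise and almost sure properties\<close>

definition wigner_noise ::
    "'w measure \<Rightarrow> real \<Rightarrow> nat \<Rightarrow> nat \<Rightarrow> ('w \<Rightarrow> real mat) \<Rightarrow> bool" where
  "wigner_noise M K m n W \<longleftrightarrow>
     (\<forall>\<omega>\<in>space M. W \<omega> \<in> carrier_mat m n) \<and>
     prob_space.indep_vars M (\<lambda>_. borel) (\<lambda>ij \<omega>. W \<omega> $$ ij) ({..<m} \<times> {..<n}) \<and>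
     (\<forall>i<m. \<forall>j<n. prob_space.expectation M (\<lambda>\<omega>. W \<omega> $$ (i, j)) = 0 \<and>
                   (AE \<omega> in M. \<bar>W \<omega> $$ (i, j)\<bar> \<le> K))"

text \<open>The set \<open>J\<close> consists of the sizes \<open>(m, n)\<close> through which the matrices grow; a growth
  condition bounding \<open>m\<close> and \<open>n\<close> in terms of each other cannot hold for all pairs.\<close>

definition almost_surely ::
    "'w measure \<Rightarrow> (nat \<times> nat) set \<Rightarrow> (nat \<Rightarrow> nat \<Rightarrow> 'w \<Rightarrow> bool) \<Rightarrow> bool" where
  "almost_surely M J Q \<longleftrightarrow>
     (AE \<omega> in M. \<exists>m0 n0. \<forall>m\<ge>m0. \<forall>n\<ge>n0. (m, n) \<in> J \<longrightarrow> Q m n \<omega>)"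

definition eps :: "real \<Rightarrow> nat \<Rightarrow> nat \<Rightarrow> real" where
  "eps \<tau> m n = max (real n powr - \<tau>) (real m powr - \<tau>)"

subsection \<open>Correspondence transformation\<close>

definition row_sum :: "real mat \<Rightarrow> nat \<Rightarrow> real" where
  "row_sum A i = (\<Sum>j<dim_col A. A $$ (i, j))"

definition col_sum :: "real mat \<Rightarrow> nat \<Rightarrow> real" where
  "col_sum A j = (\<Sum>i<dim_row A. A $$ (i, j))"

text \<open>The next three definitions have their intended meaning only if all row and column sums
  are positive; otherwise they follow the conventions \<open>1 / 0 = 0\<close> and \<open>sqrt (- x) = - sqrt x\<close>.\<close>

definition inv_sqrt_Drow :: "real mat \<Rightarrow> real mat" where
  "inv_sqrt_Drow A = mat_diag (dim_row A) (\<lambda>i. 1 / sqrt (row_sum A i))"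

definition inv_sqrt_Dcol :: "real mat \<Rightarrow> real mat" where
  "inv_sqrt_Dcol A = mat_diag (dim_col A) (\<lambda>j. 1 / sqrt (col_sum A j))"

definition corr :: "real mat \<Rightarrow> real mat" where
  "corr A = inv_sqrt_Drow A * A * inv_sqrt_Dcol A"

subsection \<open>Singular values and singular vectors\<close>

text \<open>The singular values in non-increasing order, with multiplicities. If \<open>A\<close> is \<open>m \<times> n\<close>
  with \<open>m < n\<close>, the matrix \<open>A\<^sup>T A\<close> has at least \<open>n - m\<close> zero eigenvalues that are not counted
  as singular values of \<open>A\<close>, whence the truncation.\<close>

definition singular_values :: "real mat \<Rightarrow> real list" where
  "singular_values A =
     take (min (dim_row A) (dim_col A))
       (rev (sorted_list_of_multiset
          (image_mset sqrt (proots (char_poly (transpose_mat A * A))))))"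

definition orthonormal_vecs :: "nat \<Rightarrow> real Matrix.vec list \<Rightarrow> bool" where
  "orthonormal_vecs n vs \<longleftrightarrow> set vs \<subseteq> carrier_vec n \<and>
     (\<forall>i<length vs. \<forall>j<length vs. scalar_prod (vs ! i) (vs ! j) = (if i = j then 1 else 0))"

definition top_singular_vectors ::
    "real mat \<Rightarrow> nat \<Rightarrow> real Matrix.vec list \<Rightarrow> real Matrix.vec list \<Rightarrow> bool" where
  "top_singular_vectors A r ys xs \<longleftrightarrow>
     length ys = r \<and> length xs = r \<and>
     orthonormal_vecs (dim_row A) ys \<and> orthonormal_vecs (dim_col A) xs \<and>
     (\<forall>i<r. A *\<^sub>v (xs ! i) = (singular_values A ! i) \<cdot>\<^sub>v (ys ! i) \<and>
            transpose_mat A *\<^sub>v (ys ! i) = (singular_values A ! i) \<cdot>\<^sub>v (xs ! i))"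

definition singular_value_gap :: "real mat \<Rightarrow> nat \<Rightarrow> real \<Rightarrow> real \<Rightarrow> bool" where
  "singular_value_gap A r \<delta> \<epsilon> \<longleftrightarrow>
     (\<forall>i<length (singular_values A).
        (i < r \<longrightarrow> singular_values A ! i \<in> {\<delta> - \<epsilon> .. 1 + \<epsilon>}) \<and>
        (r \<le> i \<longrightarrow> singular_values A ! i \<le> \<epsilon>))"

subsection \<open>Weighted variances\<close>

definition weighted_mean :: "(nat \<Rightarrow> real) \<Rightarrow> real mat \<Rightarrow> nat set \<Rightarrow> real Matrix.vec" where
  "weighted_mean d Y S =
     Matrix.vec (dim_col Y) (\<lambda>k. (\<Sum>j\<in>S. d j * Y $$ (j, k)) / (\<Sum>j\<in>S. d j))"

definition sq_dist :: "real Matrix.vec \<Rightarrow> real Matrix.vec \<Rightarrow> real" where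
  "sq_dist u v = scalar_prod (u - v) (u - v)"

text \<open>The minimum is meaningful for \<open>k \<le> dim_row Y\<close>, when there are partitions into \<open>k\<close>
  (nonempty) parts.\<close>

definition weighted_variance :: "(nat \<Rightarrow> real) \<Rightarrow> nat \<Rightarrow> real mat \<Rightarrow> real" where
  "weighted_variance d k Y =
     Min ((\<lambda>Q. \<Sum>S\<in>Q. \<Sum>j\<in>S. d j * sq_dist (Matrix.row Y j) (weighted_mean d Y S)) `
          {Q. partition_on {..<dim_row Y} Q \<and> card Q = k})"

definition Y_corr :: "real mat \<Rightarrow> real Matrix.vec list \<Rightarrow> real mat" where
  "Y_corr A ys = mat_of_cols (dim_row A) (map (\<lambda>y. inv_sqrt_Drow A *\<^sub>v y) ys)"

definition X_corr :: "real mat \<Rightarrow> real Matrix.vec list \<Rightarrow> real mat" where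
  "X_corr A xs = mat_of_cols (dim_col A) (map (\<lambda>x. inv_sqrt_Dcol A *\<^sub>v x) xs)"

end

theory Submission
  imports Defs "HOL-Real_Asymp.Real_Asymp"
begin

text \<open>Rescaling a pair of singular vectors to \<open>\<eta> = D_row^(-1/2) y\<close> and \<open>\<xi> = D_col^(-1/2) x\<close> turns the
  singular vector equations into \<open>A \<xi> = z D_row \<eta>\<close> and \<open>A\<^sup>T \<eta> = z D_col \<xi>\<close>. Replacing \<open>A\<close> and its row
  sums by \<open>B\<close> and the row sums of \<open>B\<close> gives a vector that is constant on blocks, and the error is
  governed by \<open>W \<xi>\<close>. Split \<open>\<xi>\<close> into a vector constant on blocks and a remainder: on the former \<open>W\<close> acts
  through its block sums, which Hoeffding's inequality bounds, and on the latter a crude bound on the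
  operator norm suffices, because it makes the two errors, that of \<open>\<eta>\<close> and that of \<open>\<xi>\<close>, bound
  each other with a contraction factor. The crude bound \<open>o(sqrt (m n))\<close> for the norm of \<open>W\<close> comes from the entries
  of \<open>W W\<^sup>T\<close>, again by Hoeffding's inequality. The resulting error is of order \<open>eps \<tau>'\<close> for
  some \<open>\<tau> < \<tau>' < 1 / 2\<close>, hence eventually smaller than any multiple of \<open>eps \<tau>\<close>, and the
  exceptional probabilities are summable over all sizes by GC2.\<close>

section \<open>Singular values\<close>

text \<open>The Hermitian form \<open>Q\<close> of \<open>S\<close> at an eigenvector equals
  \<open>z * N\<close> with \<open>N\<close> the squared norm. \<open>Q\<close> is real by symmetry
  and \<open>N\<close> is real and nonzero, so \<open>z\<close> is real.\<close>

lemma symmetric_complex_eigenvalue_real: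
  fixes S :: "real mat"
  assumes S: "S \<in> carrier_mat n n" and sym: "transpose_mat S = S"
    and ev: "eigenvalue (map_mat complex_of_real S) z"
  shows "z \<in> \<real>"
proof -
  from ev obtain v where v: "v \<in> carrier_vec n" "v \<noteq> 0\<^sub>v n"
    and eq: "map_mat complex_of_real S *\<^sub>v v = z \<cdot>\<^sub>v v"
    using S unfolding eigenvalue_def eigenvector_def by auto
  define f where "f i = vec_index v i" for i
  define s where "s i j = complex_of_real (S $$ (i, j))" for i j
  have eq': "(\<Sum>j<n. s i j * f j) = z * f i" if "i < n" for i
  proof -
    have "vec_index (map_mat complex_of_real S *\<^sub>v v) i = vec_index (z \<cdot>\<^sub>v v) i" by (simp add: eq)
    then show ?thesis using that v S
      by (simp add: scalar_prod_def f_def s_def lessThan_atLeast0)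
  qed
  have s_sym: "s i j = s j i" if "i < n" "j < n" for i j
    using sym S that unfolding s_def by (metis carrier_matD index_transpose_mat(1))
  define Q where "Q = (\<Sum>i<n. \<Sum>j<n. cnj (f i) * (s i j * f j))"
  define N where "N = (\<Sum>i<n. cnj (f i) * f i)"
  have "Q = z * N"
  proof -
    have "Q = (\<Sum>i<n. cnj (f i) * (\<Sum>j<n. s i j * f j))"
      by (simp add: Q_def sum_distrib_left)
    also have "\<dots> = (\<Sum>i<n. cnj (f i) * (z * f i))"
      by (intro sum.cong refl) (simp only: eq' lessThan_iff)
    also have "\<dots> = z * N" by (simp add: N_def sum_distrib_left mult_ac)
    finally show ?thesis .
  qed
  moreover have "cnj Q = Q"
  proof -
    have "cnj Q = (\<Sum>i<n. \<Sum>j<n. cnj (f j) * (s i j * f i))"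
      by (simp add: Q_def s_def mult_ac)
    also have "\<dots> = (\<Sum>j<n. \<Sum>i<n. cnj (f j) * (s j i * f i))"
      by (subst sum.swap) (auto intro!: sum.cong simp: s_sym)
    finally show ?thesis by (simp add: Q_def)
  qed
  moreover have "cnj N = N" by (simp add: N_def mult.commute)
  moreover have "N \<noteq> 0"
  proof
    assume "N = 0"
    moreover have "N = of_real (\<Sum>i<n. (cmod (f i))\<^sup>2)"
      by (simp add: N_def complex_norm_square mult.commute del: of_real_power)
    ultimately have "(\<Sum>i<n. (cmod (f i))\<^sup>2) = 0" by (simp del: of_real_sum)
    then have "\<forall>i<n. f i = 0" by (subst (asm) sum_nonneg_eq_0_iff) auto
    then have "v = 0\<^sub>v n" using v by (intro eq_vecI) (auto simp: f_def)
    then show False using v by simp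
  qed
  ultimately have "cnj z = z" by (metis complex_cnj_mult mult_right_cancel)
  then show ?thesis by (simp add: Reals_cnj_iff)
qed

text \<open>\<open>proots\<close> counts real roots only. Over the complex numbers the polynomial
  splits into \<open>n\<close> linear factors; all its roots are real, so the factorization descends
  to the reals.\<close>

lemma size_proots_char_poly_symmetric:
  fixes S :: "real mat"
  assumes S: "S \<in> carrier_mat n n" and sym: "transpose_mat S = S"
  shows "size (proots (char_poly S)) = n"
proof -
  interpret h: map_poly_inj_comm_ring_hom complex_of_real ..
  let ?C = "map_mat complex_of_real S"
  have C: "?C \<in> carrier_mat n n" using S by simp
  obtain as where as: "char_poly ?C = (\<Prod>a\<leftarrow>as. [:- a, 1:])" "length as = n"
    using char_poly_factorized[OF C] by blast
  have real: "a \<in> \<real>" if "a \<in> set as" for a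
  proof -
    have "poly (char_poly ?C) a = 0"
      using that unfolding as poly_prod_list by (simp add: prod_list_zero_iff image_iff)
    then show ?thesis
      using symmetric_complex_eigenvalue_real[OF S sym] eigenvalue_root_char_poly[OF C] by blast
  qed
  have "map_poly complex_of_real (char_poly S) = (\<Prod>a\<leftarrow>as. [:- a, 1:])"
    using as by (simp add: of_real_hom.char_poly_hom[OF S, symmetric])
  also have "\<dots> = (\<Prod>a\<leftarrow>as. map_poly complex_of_real [:- Re a, 1:])"
  proof -
    have "[:- a, 1:] = map_poly complex_of_real [:- Re a, 1:]" if "a \<in> set as" for a
      using real[OF that] by simp
    then show ?thesis by (intro arg_cong[where f = prod_list] map_cong refl)
  qed
  also have "\<dots> = map_poly complex_of_real (\<Prod>a\<leftarrow>as. [:- Re a, 1:])"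
  proof -
    have "(\<Prod>x\<leftarrow>xs. map_poly complex_of_real (f x)) = map_poly complex_of_real (\<Prod>x\<leftarrow>xs. f x)"
      for f :: "complex \<Rightarrow> real poly" and xs
      by (induction xs) (simp_all add: h.hom_mult)
    then show ?thesis .
  qed
  finally have "char_poly S = (\<Prod>a\<leftarrow>as. [:- Re a, 1:])"
    by (rule h.injectivity)
  moreover have "size (proots (\<Prod>a\<leftarrow>as. [:- Re a, 1:])) = length as"
  proof (induction as)
    case (Cons a as)
    have "(\<Prod>a\<leftarrow>as. [:- Re a, 1:]) \<noteq> 0" by (auto simp: prod_list_zero_iff)
    then show ?case using Cons by (simp add: proots_mult del: mult_pCons_left)
  qed simp
  ultimately show ?thesis using as by simp
qed

text \<open>\<open>singular_value_gap\<close> speaks only of positions inside the list of singular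
  values. This shows that the first \<open>r\<close> positions exist as soon as both dimensions are
  at least \<open>r\<close>.\<close>

lemma length_singular_values:
  "length (singular_values X) = min (dim_row X) (dim_col X)"
proof -
  have "size (proots (char_poly (transpose_mat X * X))) = dim_col X"
    by (rule size_proots_char_poly_symmetric) (auto simp: transpose_mult[of _ "dim_col X" "dim_row X" _ "dim_col X"])
  then have "length (sorted_list_of_multiset
      (image_mset sqrt (proots (char_poly (transpose_mat X * X))))) = dim_col X"
    by (metis mset_sorted_list_of_multiset size_image_mset size_mset)
  then show ?thesis by (simp add: singular_values_def)
qed

section \<open>Blocks and weighted variances\<close>

lemma block_of_less:
  assumes "k < (\<Sum>i<a. sz i)"
  shows "block_of sz k < a"
proof (cases a)
  case (Suc a')
  then have "k < (\<Sum>i'\<le>a'. sz i')" using assms by (simp add: lessThan_Suc_atMost)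
  then have "block_of sz k \<le> a'" unfolding block_of_def by (rule Least_le)
  then show ?thesis using Suc by simp
qed (use assms in simp)

text \<open>Blocks are consecutive half-open intervals between partial sums of the sizes, which
  makes them countable in \<open>card_block\<close>.\<close>

lemma block_of_eq_iff:
  assumes "k < (\<Sum>i<a. sz i)" "i < a"
  shows "block_of sz k = i \<longleftrightarrow> (\<Sum>i'<i. sz i') \<le> k \<and> k < (\<Sum>i'<Suc i. sz i')"
proof
  assume i: "block_of sz k = i"
  have "k < (\<Sum>i'\<le>a-1. sz i')"
    using assms by (metis Suc_pred' gr_implies_not_zero lessThan_Suc_atMost neq0_conv)
  then have "k < (\<Sum>i'\<le>i. sz i')" unfolding i[symmetric] block_of_def by (rule LeastI)
  moreover have "(\<Sum>i'<i. sz i') \<le> k"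
  proof (cases i)
    case (Suc i0)
    have "\<not> k < (\<Sum>i'\<le>i0. sz i')"
      using i Suc not_less_Least[of i0 "\<lambda>i. k < (\<Sum>i'\<le>i. sz i')"] by (simp add: block_of_def)
    then show ?thesis using Suc by (simp add: lessThan_Suc_atMost)
  qed simp
  ultimately show "(\<Sum>i'<i. sz i') \<le> k \<and> k < (\<Sum>i'<Suc i. sz i')"
    by (simp add: lessThan_Suc_atMost)
next
  assume k: "(\<Sum>i'<i. sz i') \<le> k \<and> k < (\<Sum>i'<Suc i. sz i')"
  show "block_of sz k = i" unfolding block_of_def
  proof (rule Least_equality)
    show "k < (\<Sum>i'\<le>i. sz i')" using k by (simp add: lessThan_Suc_atMost)
  next
    fix y assume y: "k < (\<Sum>i'\<le>y. sz i')"
    show "i \<le> y"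
    proof (rule ccontr)
      assume "\<not> i \<le> y"
      then have "(\<Sum>i'\<le>y. sz i') \<le> (\<Sum>i'<i. sz i')" by (intro sum_mono2) auto
      then show False using y k by simp
    qed
  qed
qed

lemma card_block:
  assumes "i < a" "(\<Sum>i<a. sz i) = m"
  shows "card {k. k < m \<and> block_of sz k = i} = sz i"
proof -
  have "(\<Sum>i'<Suc i. sz i') \<le> m"
    unfolding assms(2)[symmetric] using assms(1) by (intro sum_mono2) auto
  then have "{k. k < m \<and> block_of sz k = i} = {(\<Sum>i'<i. sz i')..<(\<Sum>i'<Suc i. sz i')}"
    using block_of_eq_iff[of _ sz a i] assms by fastforce
  then show ?thesis by simp
qed

text \<open>Steiner's identity: moving the centre from the mean \<open>\<mu>\<close> to
  \<open>t\<close> adds exactly \<open>D\<close> times the squared shift.\<close>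

lemma weighted_mean_minimizes:
  fixes d y :: "'i \<Rightarrow> real"
  assumes "finite S" and d: "\<And>j. j \<in> S \<Longrightarrow> 0 < d j"
  shows "(\<Sum>j\<in>S. d j * (y j - (\<Sum>j\<in>S. d j * y j) / (\<Sum>j\<in>S. d j))\<^sup>2) \<le> (\<Sum>j\<in>S. d j * (y j - t)\<^sup>2)"
proof (cases "S = {}")
  case False
  define D where "D = (\<Sum>j\<in>S. d j)"
  define \<mu> where "\<mu> = (\<Sum>j\<in>S. d j * y j) / D"
  have D: "0 < D" unfolding D_def using assms False by (intro sum_pos) auto
  have *: "(\<Sum>j\<in>S. d j * y j) = D * \<mu>" using D by (simp add: \<mu>_def)
  \<comment> \<open>The terms are arranged so that, apart from the squares around
    \<open>\<mu>\<close>, each is a constant times \<open>d j * y j\<close> or \<open>d j\<close>,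
    whose sums are \<open>D * \<mu>\<close> and \<open>D\<close>.\<close>
  have "(\<Sum>j\<in>S. d j * (y j - t)\<^sup>2)
      = (\<Sum>j\<in>S. d j * (y j - \<mu>)\<^sup>2 + (2 * (\<mu> - t)) * (d j * y j) - (2 * (\<mu> - t) * \<mu>) * d j + (\<mu> - t)\<^sup>2 * d j)"
    by (intro sum.cong refl) (simp add: power2_eq_square algebra_simps)
  also have "\<dots> = (\<Sum>j\<in>S. d j * (y j - \<mu>)\<^sup>2) + 2 * (\<mu> - t) * (D * \<mu>) - (2 * (\<mu> - t) * \<mu>) * D + (\<mu> - t)\<^sup>2 * D"
    by (simp add: sum.distrib sum_subtractf * D_def flip: sum_distrib_left)
  also have "\<dots> = (\<Sum>j\<in>S. d j * (y j - \<mu>)\<^sup>2) + (\<mu> - t)\<^sup>2 * D"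
    by (simp add: algebra_simps)
  finally show ?thesis using D by (simp add: \<mu>_def D_def)
qed simp

text \<open>The partition into blocks is one competitor in the minimum, and replacing its weighted
  means by arbitrary centres \<open>t\<close> can only increase the cost. Surjectivity of
  \<open>blk\<close> makes the blocks nonempty and distinct, so there are exactly \<open>a\<close>
  of them. The cost splits over the \<open>r\<close> coordinates.\<close>

lemma weighted_variance_le:
  fixes t :: "nat \<Rightarrow> nat \<Rightarrow> real"
  assumes Y: "Y \<in> carrier_mat m r" and d: "\<And>j. j < m \<Longrightarrow> 0 < d j"
    and blk: "\<And>k. k < m \<Longrightarrow> blk k < a" and surj: "\<And>i. i < a \<Longrightarrow> \<exists>k<m. blk k = i"
    and le: "\<And>c. c < r \<Longrightarrow> (\<Sum>j<m. d j * (Y $$ (j, c) - t c (blk j))\<^sup>2) \<le> e"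
  shows "weighted_variance d a Y \<le> r * e"
proof -
  define B where "B i = {k. k < m \<and> blk k = i}" for i
  define Q where "Q = B ` {..<a}"
  define cost where "cost Q = (\<Sum>S\<in>Q. \<Sum>j\<in>S. d j * sq_dist (Matrix.row Y j) (weighted_mean d Y S))" for Q
  have inj: "inj_on B {..<a}"
  proof (rule inj_onI)
    fix i i' assume "i \<in> {..<a}" "i' \<in> {..<a}" "B i = B i'"
    then show "i = i'" using surj[of i] unfolding B_def by blast
  qed
  have part: "partition_on {..<m} Q"
  proof (rule partition_onI)
    show "\<Union> Q = {..<m}" using blk by (auto simp: Q_def B_def)
    show "disjnt p p'" if "p \<in> Q" "p' \<in> Q" "p \<noteq> p'" for p p'
      using that by (auto simp: Q_def B_def disjnt_def)
    show "{} \<notin> Q" using surj by (auto simp: Q_def B_def)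
  qed
  have card: "card Q = a" unfolding Q_def using inj by (simp add: card_image)
  have "{Q. partition_on {..<m} Q \<and> card Q = a} \<subseteq> Pow (Pow {..<m})"
    by (auto simp: partition_on_def)
  then have fin: "finite {Q. partition_on {..<m} Q \<and> card Q = a}"
    by (rule finite_subset) simp
  have "weighted_variance d a Y = Min (cost ` {Q. partition_on {..<m} Q \<and> card Q = a})"
    using Y by (simp add: weighted_variance_def cost_def [abs_def])
  also have "\<dots> \<le> cost Q" using fin part card by (intro Min_le) auto
  also have "cost Q = (\<Sum>i<a. \<Sum>j\<in>B i. d j * sq_dist (Matrix.row Y j) (weighted_mean d Y (B i)))"
    unfolding cost_def Q_def using inj by (simp add: sum.reindex)
  also have "\<dots> \<le> (\<Sum>i<a. \<Sum>j\<in>B i. \<Sum>c<r. d j * (Y $$ (j, c) - t c i)\<^sup>2)"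
  proof (rule sum_mono)
    fix i assume "i \<in> {..<a}"
    have "(\<Sum>j\<in>B i. d j * sq_dist (Matrix.row Y j) (weighted_mean d Y (B i)))
      = (\<Sum>j\<in>B i. \<Sum>c<r. d j * (Y $$ (j, c) - (\<Sum>j\<in>B i. d j * Y $$ (j, c)) / (\<Sum>j\<in>B i. d j))\<^sup>2)"
    proof (intro sum.cong refl)
      fix j assume "j \<in> B i"
      then have "j < m" by (simp add: B_def)
      then show "d j * sq_dist (Matrix.row Y j) (weighted_mean d Y (B i))
        = (\<Sum>c<r. d j * (Y $$ (j, c) - (\<Sum>j\<in>B i. d j * Y $$ (j, c)) / (\<Sum>j\<in>B i. d j))\<^sup>2)"
        using Y by (simp add: sq_dist_def scalar_prod_def weighted_mean_def power2_eq_square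
            sum_distrib_left lessThan_atLeast0)
    qed
    also have "\<dots> = (\<Sum>c<r. \<Sum>j\<in>B i. d j * (Y $$ (j, c) - (\<Sum>j\<in>B i. d j * Y $$ (j, c)) / (\<Sum>j\<in>B i. d j))\<^sup>2)"
      by (rule sum.swap)
    also have "\<dots> \<le> (\<Sum>c<r. \<Sum>j\<in>B i. d j * (Y $$ (j, c) - t c i)\<^sup>2)"
      using d by (intro sum_mono weighted_mean_minimizes) (auto simp: B_def)
    also have "\<dots> = (\<Sum>j\<in>B i. \<Sum>c<r. d j * (Y $$ (j, c) - t c i)\<^sup>2)" by (rule sum.swap)
    finally show "(\<Sum>j\<in>B i. d j * sq_dist (Matrix.row Y j) (weighted_mean d Y (B i)))
      \<le> (\<Sum>j\<in>B i. \<Sum>c<r. d j * (Y $$ (j, c) - t c i)\<^sup>2)" .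
  qed
  also have "\<dots> = (\<Sum>i<a. \<Sum>j\<in>B i. \<Sum>c<r. d j * (Y $$ (j, c) - t c (blk j))\<^sup>2)"
    by (intro sum.cong refl) (simp add: B_def)
  also have "\<dots> = (\<Sum>j<m. \<Sum>c<r. d j * (Y $$ (j, c) - t c (blk j))\<^sup>2)"
    using blk sum.group[of "{..<m}" "{..<a}" blk "\<lambda>j. \<Sum>c<r. d j * (Y $$ (j, c) - t c (blk j))\<^sup>2"]
    by (auto simp: B_def)
  also have "\<dots> = (\<Sum>c<r. \<Sum>j<m. d j * (Y $$ (j, c) - t c (blk j))\<^sup>2)" by (rule sum.swap)
  also have "\<dots> \<le> (\<Sum>c<r. e)" using le by (intro sum_mono) auto
  finally show ?thesis by simp
qed

section \<open>Deterministic perturbation bounds\<close>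

text \<open>A matrix and its transpose have the same operator norm: for \<open>u = w v\<close> the
  squared norm \<open>S\<close> of \<open>u\<close> is the inner product of the transpose applied to
  \<open>u\<close> with \<open>v\<close>, so Cauchy-Schwarz gives
  \<open>S * S \<le> c * S * V\<close>, and \<open>S\<close> cancels.\<close>

lemma operator_bound_transpose:
  fixes w :: "nat \<Rightarrow> nat \<Rightarrow> real"
  assumes c: "0 \<le> c"
    and le: "\<And>u. (\<Sum>l<n. (\<Sum>k<m. w k l * u k)\<^sup>2) \<le> c * (\<Sum>k<m. (u k)\<^sup>2)"
  shows "(\<Sum>k<m. (\<Sum>l<n. w k l * v l)\<^sup>2) \<le> c * (\<Sum>l<n. (v l)\<^sup>2)"
proof -
  define u where "u k = (\<Sum>l<n. w k l * v l)" for k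
  define S where "S = (\<Sum>k<m. (u k)\<^sup>2)"
  define V where "V = (\<Sum>l<n. (v l)\<^sup>2)"
  have V0: "0 \<le> V" and S0: "0 \<le> S" unfolding V_def S_def by (auto intro: sum_nonneg)
  have "S = (\<Sum>k<m. \<Sum>l<n. u k * (w k l * v l))"
    unfolding S_def power2_eq_square by (simp add: u_def sum_distrib_left)
  also have "\<dots> = (\<Sum>l<n. (\<Sum>k<m. w k l * u k) * v l)"
    by (subst sum.swap) (simp add: sum_distrib_left mult_ac)
  finally have S_eq: "S = (\<Sum>l<n. (\<Sum>k<m. w k l * u k) * v l)" .
  have "S\<^sup>2 \<le> (\<Sum>l<n. (\<Sum>k<m. w k l * u k)\<^sup>2) * V"
    unfolding S_eq V_def by (rule Cauchy_Schwarz_ineq_sum)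
  also have "\<dots> \<le> c * S * V"
    using le[of u] V0 by (intro mult_right_mono) (auto simp: S_def)
  finally have "S * S \<le> S * (c * V)" by (simp add: power2_eq_square mult_ac)
  then have "S \<le> c * V"
    using S0 c V0 by (cases "S = 0") auto
  then show ?thesis by (simp add: S_def V_def u_def)
qed

text \<open>The left side is the quadratic form of the Gram matrix of the rows. Its diagonal
  contributes at most \<open>K\<^sup>2 * n\<close>; the off-diagonal entries, at most
  \<open>t\<close> in absolute value, contribute \<open>t * m\<close> by the inequality between
  geometric and arithmetic means.\<close>

lemma gram_operator_bound:
  fixes w :: "nat \<Rightarrow> nat \<Rightarrow> real"
  assumes K: "\<And>k l. k < m \<Longrightarrow> l < n \<Longrightarrow> \<bar>w k l\<bar> \<le> K"
    and off: "\<And>k k'. k < m \<Longrightarrow> k' < m \<Longrightarrow> k \<noteq> k' \<Longrightarrow> \<bar>\<Sum>l<n. w k l * w k' l\<bar> \<le> t"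
    and t: "0 \<le> t"
  shows "(\<Sum>l<n. (\<Sum>k<m. w k l * u k)\<^sup>2) \<le> (K\<^sup>2 * n + t * m) * (\<Sum>k<m. (u k)\<^sup>2)"
proof -
  define G where "G k k' = (\<Sum>l<n. w k l * w k' l)" for k k'
  have G: "G k k' \<le> t" "- G k k' \<le> t" if "k < m" "k' < m" "k \<noteq> k'" for k k'
    using off[OF that] by (auto simp: G_def)
  have Gd: "G k k \<le> K\<^sup>2 * n" if "k < m" for k
  proof -
    have "w k l * w k l \<le> K\<^sup>2" if "l < n" for l
    proof -
      have "\<bar>w k l\<bar>\<^sup>2 \<le> K\<^sup>2" using K[OF \<open>k < m\<close> that] by (intro power_mono) auto
      then show ?thesis by (simp add: power2_eq_square)
    qed
    then have "G k k \<le> (\<Sum>l<n. K\<^sup>2)" unfolding G_def by (intro sum_mono) auto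
    then show ?thesis by (simp add: mult.commute)
  qed
  \<comment> \<open>The summand with \<open>t\<close> is kept on the diagonal as well, so that the
    double sum can be evaluated without excluding pairs.\<close>
  have bd: "u k * u k' * G k k' \<le> (if k = k' then K\<^sup>2 * n * (u k)\<^sup>2 else 0)
      + t * ((u k)\<^sup>2 / 2 + (u k')\<^sup>2 / 2)" if "k < m" "k' < m" for k k'
  proof (cases "k = k'")
    case True
    have "u k * u k * G k k \<le> u k * u k * (K\<^sup>2 * n)"
      using Gd[OF that(1)] by (intro mult_left_mono) auto
    moreover have "0 \<le> t * (u k)\<^sup>2" using t by simp
    ultimately show ?thesis using True by (simp add: power2_eq_square mult_ac)
  next
    case False
    have "u k * u k' * G k k' \<le> \<bar>u k * u k'\<bar> * \<bar>G k k'\<bar>"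
      by (metis abs_ge_self abs_mult)
    also have "\<dots> \<le> \<bar>u k * u k'\<bar> * t"
      using G[OF that False] by (intro mult_left_mono) auto
    also have "\<dots> \<le> ((u k)\<^sup>2 / 2 + (u k')\<^sup>2 / 2) * t"
    proof (rule mult_right_mono[OF _ t])
      have "0 \<le> (\<bar>u k\<bar> - \<bar>u k'\<bar>)\<^sup>2" by simp
      then show "\<bar>u k * u k'\<bar> \<le> (u k)\<^sup>2 / 2 + (u k')\<^sup>2 / 2"
        by (simp add: power2_diff abs_mult)
    qed
    finally show ?thesis using False by (simp add: mult.commute)
  qed
  have "(\<Sum>l<n. (\<Sum>k<m. w k l * u k)\<^sup>2) = (\<Sum>l<n. \<Sum>k<m. \<Sum>k'<m. u k * u k' * (w k l * w k' l))"
    by (simp add: power2_eq_square sum_product mult_ac)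
  also have "\<dots> = (\<Sum>k<m. \<Sum>l<n. \<Sum>k'<m. u k * u k' * (w k l * w k' l))"
    by (rule sum.swap)
  also have "\<dots> = (\<Sum>k<m. \<Sum>k'<m. u k * u k' * G k k')"
    unfolding G_def sum_distrib_left by (rule sum.cong[OF refl], rule sum.swap)
  also have "\<dots> \<le> (\<Sum>k<m. \<Sum>k'<m. (if k = k' then K\<^sup>2 * n * (u k)\<^sup>2 else 0)
      + t * ((u k)\<^sup>2 / 2 + (u k')\<^sup>2 / 2))"
    by (intro sum_mono bd) auto
  also have "\<dots> = (\<Sum>k<m. K\<^sup>2 * n * (u k)\<^sup>2) +
     (\<Sum>k<m. t * (m * ((u k)\<^sup>2 / 2) + (\<Sum>k'<m. (u k')\<^sup>2 / 2)))"
    by (simp add: sum.distrib flip: sum_distrib_left)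
  also have "\<dots> = (K\<^sup>2 * n + t * m) * (\<Sum>k<m. (u k)\<^sup>2)"
    by (simp add: sum.distrib algebra_simps flip: sum_distrib_left sum_divide_distrib)
  finally show ?thesis .
qed

section \<open>Euclidean norm estimates\<close>

lemma abs_sum_mult_le_L2_set:
  fixes f v :: "nat \<Rightarrow> real"
  assumes "\<And>l. l < n \<Longrightarrow> \<bar>f l\<bar> \<le> p" and p: "0 \<le> p"
  shows "\<bar>\<Sum>l<n. f l * v l\<bar> \<le> p * sqrt n * L2_set v {..<n}"
proof -
  have "\<bar>\<Sum>l<n. f l * v l\<bar> \<le> (\<Sum>l<n. \<bar>f l\<bar> * \<bar>v l\<bar>)"
    by (rule order_trans[OF sum_abs]) (simp add: abs_mult)
  also have "\<dots> \<le> L2_set f {..<n} * L2_set v {..<n}" by (rule L2_set_mult_ineq)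
  also have "L2_set f {..<n} \<le> p * sqrt n"
  proof -
    have "(\<Sum>l<n. (f l)\<^sup>2) \<le> (\<Sum>l<n. p\<^sup>2)"
      using assms by (intro sum_mono abs_le_square_iff[THEN iffD1]) auto
    then have "L2_set f {..<n} \<le> sqrt (n * p\<^sup>2)" unfolding L2_set_def by simp
    then show ?thesis using p by (simp add: real_sqrt_mult mult.commute)
  qed
  finally show ?thesis by (simp add: mult_right_mono L2_set_nonneg)
qed

lemma L2_set_le_const:
  fixes f :: "nat \<Rightarrow> real"
  assumes "\<And>k. k < m \<Longrightarrow> \<bar>f k\<bar> \<le> s" and "0 \<le> s"
  shows "L2_set f {..<m} \<le> sqrt m * s"
proof -
  have "(\<Sum>l<m. (f l)\<^sup>2) \<le> (\<Sum>l<m. s\<^sup>2)"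
    using assms by (intro sum_mono abs_le_square_iff[THEN iffD1]) auto
  then have "L2_set f {..<m} \<le> sqrt (m * s\<^sup>2)" unfolding L2_set_def by simp
  then show ?thesis using assms(2) by (simp add: real_sqrt_mult mult.commute)
qed

lemma L2_set_mono_abs:
  fixes f g :: "nat \<Rightarrow> real"
  assumes "\<And>k. k \<in> S \<Longrightarrow> \<bar>f k\<bar> \<le> \<bar>g k\<bar>"
  shows "L2_set f S \<le> L2_set g S"
  unfolding L2_set_def using assms
  by (intro real_sqrt_le_mono sum_mono abs_le_square_iff[THEN iffD1]) auto

text \<open>A fixed realization \<open>w\<close> of the noise on top of a pattern \<open>P\<close>
  spread out by the block maps \<open>rb\<close> and \<open>cb\<close>. The parameters are scale
  free: \<open>\<theta>\<close> measures block sums of \<open>w\<close> relative to the size,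
  \<open>\<kappa>\<close> its operator norm relative to \<open>sqrt (m * n)\<close>. The factor 2
  before \<open>g\<close> leaves room for the noise, so that noisy row and column sums stay above
  \<open>g\<close> times the size. The hypotheses are symmetric under transposition, so row
  statements also give column statements.\<close>

locale block_perturbation =
  fixes m n a b :: nat and rb cb :: "nat \<Rightarrow> nat" and P w :: "nat \<Rightarrow> nat \<Rightarrow> real"
    and p g \<theta> \<kappa> :: real
  assumes m: "0 < m" and n: "0 < n"
    and rb: "\<And>k. k < m \<Longrightarrow> rb k < a" and cb: "\<And>l. l < n \<Longrightarrow> cb l < b"
    and P_bound: "\<And>i j. i < a \<Longrightarrow> j < b \<Longrightarrow> \<bar>P i j\<bar> \<le> p"
    and row_lower: "\<And>k. k < m \<Longrightarrow> 2 * g * n \<le> (\<Sum>l<n. P (rb k) (cb l))"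
    and col_lower: "\<And>l. l < n \<Longrightarrow> 2 * g * m \<le> (\<Sum>k<m. P (rb k) (cb l))"
    and g: "0 < g" and \<theta>: "0 \<le> \<theta>" and \<kappa>: "0 \<le> \<kappa>" and p: "0 \<le> p"
    and noise_row: "\<And>k j. k < m \<Longrightarrow> j < b \<Longrightarrow> \<bar>\<Sum>l | l < n \<and> cb l = j. w k l\<bar> \<le> \<theta> * n"
    and noise_col: "\<And>l i. l < n \<Longrightarrow> i < a \<Longrightarrow> \<bar>\<Sum>k | k < m \<and> rb k = i. w k l\<bar> \<le> \<theta> * m"
    and noise_op: "\<And>v. (\<Sum>k<m. (\<Sum>l<n. w k l * v l)\<^sup>2) \<le> \<kappa>\<^sup>2 * (m * n) * (\<Sum>l<n. (v l)\<^sup>2)"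
    and noise_op': "\<And>u. (\<Sum>l<n. (\<Sum>k<m. w k l * u k)\<^sup>2) \<le> \<kappa>\<^sup>2 * (m * n) * (\<Sum>k<m. (u k)\<^sup>2)"
    and \<theta>_small: "(a + b) * \<theta> \<le> g"
begin

definition entry :: "nat \<Rightarrow> nat \<Rightarrow> real" where "entry k l = P (rb k) (cb l) + w k l"

lemma transpose: "block_perturbation n m b a cb rb (\<lambda>j i. P i j) (\<lambda>l k. w k l) p g \<theta> \<kappa>"
  using m n rb cb P_bound row_lower col_lower g \<theta> \<kappa> p noise_row noise_col noise_op noise_op' \<theta>_small
  by unfold_locales (simp_all add: ac_simps)

text \<open>On a vector constant on column blocks \<open>w\<close> acts through its block sums only,
  each at most \<open>\<theta> * n\<close>.\<close>

lemma noise_row_step: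
  fixes s :: "nat \<Rightarrow> real" and \<sigma> :: real
  assumes k: "k < m" and s: "\<And>j. j < b \<Longrightarrow> \<bar>s j\<bar> \<le> \<sigma>" and \<sigma>: "0 \<le> \<sigma>"
  shows "\<bar>\<Sum>l<n. w k l * s (cb l)\<bar> \<le> b * \<sigma> * \<theta> * n"
proof -
  have "(\<Sum>l<n. w k l * s (cb l)) = (\<Sum>j<b. \<Sum>l | l \<in> {..<n} \<and> cb l = j. w k l * s (cb l))"
    using cb by (intro sum.group[symmetric]) auto
  also have "\<dots> = (\<Sum>j<b. s j * (\<Sum>l | l < n \<and> cb l = j. w k l))"
    by (simp add: sum_distrib_left mult.commute)
  also have "\<bar>\<dots>\<bar> \<le> (\<Sum>j<b. \<bar>s j\<bar> * \<bar>\<Sum>l | l < n \<and> cb l = j. w k l\<bar>)"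
    by (rule order_trans[OF sum_abs]) (simp add: abs_mult)
  also have "\<dots> \<le> (\<Sum>j<b. \<sigma> * (\<theta> * n))"
    using s k \<sigma> by (intro sum_mono mult_mono noise_row) auto
  finally show ?thesis by (simp add: mult_ac)
qed

lemma row_dev:
  assumes "k < m"
  shows "\<bar>(\<Sum>l<n. entry k l) - (\<Sum>l<n. P (rb k) (cb l))\<bar> \<le> b * \<theta> * n"
  using noise_row_step[OF assms, of "\<lambda>_. 1" 1] by (simp add: entry_def sum.distrib)

lemma row_ge:
  assumes "k < m"
  shows "g * n \<le> (\<Sum>l<n. entry k l)"
proof -
  have "b * \<theta> * n \<le> g * n"
    using \<theta>_small \<theta> by (intro mult_right_mono) (auto simp: algebra_simps intro: order_trans[rotated])
  then show ?thesis using row_dev[OF assms] row_lower[OF assms] by simp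
qed

lemma row_le:
  assumes "k < m"
  shows "(\<Sum>l<n. entry k l) \<le> (p + g) * n"
proof -
  have "b * \<theta> * n \<le> g * n"
    using \<theta>_small \<theta> by (intro mult_right_mono) (auto simp: algebra_simps intro: order_trans[rotated])
  moreover have "(\<Sum>l<n. P (rb k) (cb l)) \<le> (\<Sum>l<n. p)"
    using P_bound rb[OF assms] cb by (intro sum_mono) (auto dest: abs_le_D1)
  ultimately show ?thesis using row_dev[OF assms] by (simp add: algebra_simps)
qed

text \<open>The value that \<open>\<eta>\<close> would take on row block \<open>i\<close> if in
  \<open>A \<xi> = z D_row \<eta>\<close> the matrix and its row sums were replaced by the noiseless
  ones. These values later serve as cluster centres.\<close>

definition row_step :: "real \<Rightarrow> (nat \<Rightarrow> real) \<Rightarrow> nat \<Rightarrow> real" where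
  "row_step z \<xi> i = (\<Sum>l<n. P i (cb l) * \<xi> l) / (z * (\<Sum>l<n. P i (cb l)))"

definition col_step :: "real \<Rightarrow> (nat \<Rightarrow> real) \<Rightarrow> nat \<Rightarrow> real" where
  "col_step z \<eta> j = (\<Sum>k<m. P (rb k) j * \<eta> k) / (z * (\<Sum>k<m. P (rb k) j))"


text \<open>The numerator is estimated by Cauchy-Schwarz, the denominator is at least
  \<open>\<zeta> * g * m\<close>. The resulting order \<open>1 / sqrt (m * n)\<close> is what makes
  the noise on block-constant vectors harmless.\<close>

lemma col_step_bound:
  assumes z: "\<zeta> \<le> z" "0 < \<zeta>" and \<eta>: "(\<Sum>k<m. (\<eta> k)\<^sup>2) \<le> 1 / (g * n)" and l: "l < n"
  shows "\<bar>col_step z \<eta> (cb l)\<bar> \<le> p / (\<zeta> * g * sqrt g * sqrt m * sqrt n)"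
proof -
  have L: "L2_set \<eta> {..<m} \<le> 1 / (sqrt g * sqrt n)"
    using real_sqrt_le_mono[OF \<eta>] by (simp add: L2_set_def real_sqrt_mult real_sqrt_divide)
  have "\<bar>\<Sum>k<m. P (rb k) (cb l) * \<eta> k\<bar> \<le> p * sqrt m * L2_set \<eta> {..<m}"
    using P_bound rb cb l p by (intro abs_sum_mult_le_L2_set) auto
  also have "\<dots> \<le> p * sqrt m * (1 / (sqrt g * sqrt n))"
    using L p by (intro mult_left_mono) auto
  finally have num: "\<bar>\<Sum>k<m. P (rb k) (cb l) * \<eta> k\<bar> \<le> p * sqrt m * (1 / (sqrt g * sqrt n))" .
  have "g * m \<le> 2 * g * m" using g m by simp
  with col_lower[OF l] have c: "g * m \<le> (\<Sum>k<m. P (rb k) (cb l))" by linarith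
  have gm: "0 < g * m" using g m by simp
  have "\<zeta> * (g * m) \<le> z * (\<Sum>k<m. P (rb k) (cb l))"
    using z c gm by (intro mult_mono) auto
  moreover have "\<bar>z * (\<Sum>k<m. P (rb k) (cb l))\<bar> = z * (\<Sum>k<m. P (rb k) (cb l))"
    using z c gm by (intro abs_of_nonneg mult_nonneg_nonneg) auto
  ultimately have "\<bar>col_step z \<eta> (cb l)\<bar> \<le> p * sqrt m * (1 / (sqrt g * sqrt n)) / (\<zeta> * (g * m))"
    unfolding col_step_def abs_divide using num z gm p g
    by (intro frac_le) auto
  also have "\<dots> = p / (\<zeta> * g * sqrt g * sqrt m * sqrt n)"
  proof -
    define q where "q = sqrt m"
    have "real m = q * q" "q > 0" using m by (simp_all add: q_def)
    then show ?thesis by (simp add: q_def[symmetric])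
  qed
  finally show ?thesis .
qed

text \<open>The residual has three sources: the change of the row sums, the noise acting on the
  block-constant part of \<open>\<xi>\<close>, and the noise acting on the rest of
  \<open>\<xi>\<close>. The first two have order \<open>\<theta>\<close>; the third is
  \<open>\<kappa> / g\<close> times the residual of the other side. The factors
  \<open>sqrt n\<close> and \<open>sqrt m\<close> free the constants of the dimensions.\<close>

lemma row_residual_le:
  assumes z: "\<zeta> \<le> z" "0 < \<zeta>"
    and \<eta>: "(\<Sum>k<m. (\<eta> k)\<^sup>2) \<le> 1 / (g * n)" and \<xi>: "(\<Sum>l<n. (\<xi> l)\<^sup>2) \<le> 1 / (g * m)"
    and eq: "\<And>k. k < m \<Longrightarrow> (\<Sum>l<n. entry k l * \<xi> l) = z * (\<Sum>l<n. entry k l) * \<eta> k"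
  shows "sqrt n * L2_set (\<lambda>k. \<eta> k - row_step z \<xi> (rb k)) {..<m}
    \<le> (b * p * \<theta> / (g\<^sup>2 * sqrt g) + b * p * \<theta> / (\<zeta> * g\<^sup>2 * sqrt g)
        + \<kappa> / g * (sqrt m * L2_set (\<lambda>l. \<xi> l - col_step z \<eta> (cb l)) {..<n})) / \<zeta>"
proof -
  define d where "d k = (\<Sum>l<n. entry k l)" for k
  define D where "D k = (\<Sum>l<n. P (rb k) (cb l))" for k
  define B\<xi> where "B\<xi> k = (\<Sum>l<n. P (rb k) (cb l) * \<xi> l)" for k
  define s where "s l = col_step z \<eta> (cb l)" for l
  define f where "f k = (\<Sum>l<n. w k l * s l)" for k
  define h where "h k = (\<Sum>l<n. w k l * (\<xi> l - s l))" for k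
  have gn: "0 < g * n" using g n by simp
  have z0: "0 < z" using z by simp
  have d_ge: "g * n \<le> d k" if "k < m" for k using row_ge[OF that] by (simp add: d_def)
  have D_ge: "g * n \<le> D k" if "k < m" for k using row_lower[OF that] gn by (simp add: D_def)
  have \<xi>L: "L2_set \<xi> {..<n} \<le> 1 / (sqrt g * sqrt m)"
    using real_sqrt_le_mono[OF \<xi>] by (simp add: L2_set_def real_sqrt_mult real_sqrt_divide)
  have B\<xi>_le: "\<bar>B\<xi> k\<bar> \<le> p * sqrt n / (sqrt g * sqrt m)" if "k < m" for k
  proof -
    have "\<bar>B\<xi> k\<bar> \<le> p * sqrt n * L2_set \<xi> {..<n}"
      unfolding B\<xi>_def using P_bound rb cb that p by (intro abs_sum_mult_le_L2_set) auto
    also have "\<dots> \<le> p * sqrt n * (1 / (sqrt g * sqrt m))"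
      using \<xi>L p by (intro mult_left_mono) auto
    finally show ?thesis by simp
  qed
  \<comment> \<open>Here \<open>f\<close> is the noise on the block-constant part of
    \<open>\<xi>\<close> and \<open>h\<close> the noise on the remainder; the equation for
    \<open>\<eta> k\<close> is solved by dividing by \<open>z * d k\<close>.\<close>
  have split: "\<eta> k - row_step z \<xi> (rb k) = ((1 / d k - 1 / D k) * B\<xi> k + (f k + h k) / d k) / z"
    if k: "k < m" for k
  proof -
    have dD: "0 < d k" "0 < D k" using d_ge[OF k] D_ge[OF k] gn by auto
    have "(\<Sum>l<n. entry k l * \<xi> l) = B\<xi> k + (f k + h k)"
      by (simp add: entry_def B\<xi>_def f_def h_def algebra_simps sum.distrib sum_subtractf)
    then have "z * d k * \<eta> k = B\<xi> k + (f k + h k)" using eq[OF k] by (simp add: d_def)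
    then have "\<eta> k = (B\<xi> k + (f k + h k)) / (z * d k)" using dD z0 by (simp add: field_simps)
    moreover have "row_step z \<xi> (rb k) = B\<xi> k / (z * D k)"
      by (simp add: row_step_def B\<xi>_def D_def)
    ultimately show ?thesis
      using dD z0 by (simp add: add_divide_distrib diff_divide_distrib right_diff_distrib mult.commute)
  qed
  have t1: "\<bar>(1 / d k - 1 / D k) * B\<xi> k\<bar> \<le> b * \<theta> / (g\<^sup>2 * n) * (p * sqrt n / (sqrt g * sqrt m))"
    if k: "k < m" for k
  proof -
    have dD: "0 < d k" "0 < D k" using d_ge[OF k] D_ge[OF k] gn by auto
    have "\<bar>1 / d k - 1 / D k\<bar> = \<bar>d k - D k\<bar> / (d k * D k)"
      using dD by (simp add: field_simps abs_divide flip: abs_mult)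
    also have "\<dots> \<le> (b * \<theta> * n) / ((g * n) * (g * n))"
      using row_dev[OF k] d_ge[OF k] D_ge[OF k] gn
      by (intro frac_le mult_mono) (auto simp: d_def D_def)
    also have "\<dots> = b * \<theta> / (g\<^sup>2 * n)" using n by (simp add: power2_eq_square)
    finally show ?thesis unfolding abs_mult using B\<xi>_le[OF k] \<theta> by (intro mult_mono) auto
  qed
  have f_le: "\<bar>f k\<bar> \<le> b * (p / (\<zeta> * g * sqrt g * sqrt m * sqrt n)) * \<theta> * n" if k: "k < m" for k
  proof -
    \<comment> \<open>\<open>noise_row_step\<close> asks for a bound at every block number below
      \<open>b\<close>, whereas \<open>col_step_bound\<close> covers only block numbers that occur.
      The others are set to 0, which does not affect the sum.\<close>
    define s' where "s' j = (if j \<in> cb ` {..<n} then col_step z \<eta> j else 0)" for j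
    have "f k = (\<Sum>l<n. w k l * s' (cb l))" unfolding f_def s_def s'_def by (intro sum.cong) auto
    moreover have "\<bar>\<Sum>l<n. w k l * s' (cb l)\<bar> \<le> b * (p / (\<zeta> * g * sqrt g * sqrt m * sqrt n)) * \<theta> * n"
    proof (rule noise_row_step[OF k])
      show "\<bar>s' j\<bar> \<le> p / (\<zeta> * g * sqrt g * sqrt m * sqrt n)" for j
        using col_step_bound[OF z \<eta>] p g z by (auto simp: s'_def)
    qed (use p g z in simp)
    ultimately show ?thesis by simp
  qed
  have t2: "\<bar>f k / d k\<bar> \<le> b * (p / (\<zeta> * g * sqrt g * sqrt m * sqrt n)) * \<theta> * n / (g * n)"
    if k: "k < m" for k
    unfolding abs_divide using f_le[OF k] d_ge[OF k] gn p g z \<theta>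
    by (intro frac_le) auto
  \<comment> \<open>For the remainder only its Euclidean norm is controlled, so this term is bounded
    in norm through \<open>noise_op\<close> and not pointwise like the other two.\<close>
  have t3: "L2_set (\<lambda>k. h k / d k) {..<m} \<le> \<kappa> * sqrt m * sqrt n * L2_set (\<lambda>l. \<xi> l - s l) {..<n} / (g * n)"
  proof -
    have "L2_set (\<lambda>k. h k / d k) {..<m} \<le> L2_set (\<lambda>k. 1 / (g * n) * h k) {..<m}"
    proof (rule L2_set_mono_abs)
      fix k assume "k \<in> {..<m}"
      then have "\<bar>h k\<bar> / \<bar>d k\<bar> \<le> \<bar>h k\<bar> / (g * n)"
        using d_ge[of k] gn by (intro divide_left_mono) auto
      then show "\<bar>h k / d k\<bar> \<le> \<bar>1 / (g * n) * h k\<bar>" using g by (simp add: abs_mult)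
    qed
    also have "\<dots> = L2_set h {..<m} / (g * n)"
      using gn by (subst L2_set_right_distrib[symmetric]) auto
    also have "L2_set h {..<m} \<le> sqrt (\<kappa>\<^sup>2 * (m * n) * (\<Sum>l<n. (\<xi> l - s l)\<^sup>2))"
      unfolding L2_set_def h_def by (rule real_sqrt_le_mono, rule noise_op)
    also have "\<dots> = \<kappa> * sqrt m * sqrt n * L2_set (\<lambda>l. \<xi> l - s l) {..<n}"
      using \<kappa> by (simp add: real_sqrt_mult L2_set_def)
    finally show ?thesis using gn by (simp add: divide_right_mono)
  qed
  let ?T1 = "b * \<theta> / (g\<^sup>2 * n) * (p * sqrt n / (sqrt g * sqrt m))"
  let ?T2 = "b * (p / (\<zeta> * g * sqrt g * sqrt m * sqrt n)) * \<theta> * n / (g * n)"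
  let ?R = "L2_set (\<lambda>l. \<xi> l - s l) {..<n}"
  have T0: "0 \<le> ?T1" "0 \<le> ?T2" using \<theta> p g z by simp_all
  have "L2_set (\<lambda>k. \<eta> k - row_step z \<xi> (rb k)) {..<m}
      = L2_set (\<lambda>k. 1 / z * ((1 / d k - 1 / D k) * B\<xi> k + (f k / d k + h k / d k))) {..<m}"
    by (rule L2_set_cong) (auto simp: split add_divide_distrib)
  also have "\<dots> = 1 / z * L2_set (\<lambda>k. (1 / d k - 1 / D k) * B\<xi> k + (f k / d k + h k / d k)) {..<m}"
    using z0 by (subst L2_set_right_distrib) auto
  also have "\<dots> \<le> 1 / \<zeta> * (sqrt m * ?T1 + (sqrt m * ?T2 + \<kappa> * sqrt m * sqrt n * ?R / (g * n)))"
  proof (rule mult_mono)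
    show "L2_set (\<lambda>k. (1 / d k - 1 / D k) * B\<xi> k + (f k / d k + h k / d k)) {..<m}
        \<le> sqrt m * ?T1 + (sqrt m * ?T2 + \<kappa> * sqrt m * sqrt n * ?R / (g * n))"
      by (intro order_trans[OF L2_set_triangle_ineq] add_mono t3 L2_set_le_const t1 t2 T0)
  qed (use z in \<open>auto simp: L2_set_nonneg intro: divide_left_mono\<close>)
  finally have "sqrt n * L2_set (\<lambda>k. \<eta> k - row_step z \<xi> (rb k)) {..<m} \<le>
     sqrt n * (1 / \<zeta> * (sqrt m * ?T1 + (sqrt m * ?T2 + \<kappa> * sqrt m * sqrt n * ?R / (g * n))))"
    by (rule mult_left_mono) simp
  also have "sqrt n * (1 / \<zeta> * (sqrt m * x + (sqrt m * y + u)))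
      = (sqrt n * sqrt m * x + (sqrt n * sqrt m * y + sqrt n * u)) / \<zeta>" for x y u
    using z by (simp add: field_simps)
  also have "sqrt n * sqrt m * ?T1 = b * p * \<theta> / (g\<^sup>2 * sqrt g)"
  proof -
    have "real n = sqrt n * sqrt n" "sqrt m > 0" using m by simp_all
    then show ?thesis using n by (simp add: field_simps)
  qed
  also have "sqrt n * sqrt m * ?T2 = b * p * \<theta> / (\<zeta> * g\<^sup>2 * sqrt g)"
    using m n by (simp add: field_simps power2_eq_square)
  also have "sqrt n * (\<kappa> * sqrt m * sqrt n * ?R / (g * n)) = \<kappa> / g * (sqrt m * ?R)"
  proof -
    define q where "q = sqrt n"
    have "real n = q * q" "q > 0" using n by (simp_all add: q_def)
    then show ?thesis by (simp add: q_def[symmetric])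
  qed
  finally show ?thesis by (simp only: s_def add.assoc)
qed


text \<open>The residual bound and its transpose form a coupled pair of inequalities for
  \<open>\<alpha>\<close> and \<open>\<beta>\<close>. Since
  \<open>\<kappa> / g \<le> \<zeta> / 2\<close>, each residual enters the bound of the other with
  factor 1/2, and the system can be solved. Finally the row sums, at most
  \<open>(p + g) * n\<close>, turn the Euclidean bound into a weighted one.\<close>

lemma row_step_approx:
  assumes z: "\<zeta> \<le> z" "0 < \<zeta>" and \<kappa>_small: "\<kappa> / g \<le> \<zeta> / 2"
    and \<eta>: "(\<Sum>k<m. (\<Sum>l<n. entry k l) * (\<eta> k)\<^sup>2) = 1"
    and \<xi>: "(\<Sum>l<n. (\<Sum>k<m. entry k l) * (\<xi> l)\<^sup>2) = 1"
    and eq: "\<And>k. k < m \<Longrightarrow> (\<Sum>l<n. entry k l * \<xi> l) = z * (\<Sum>l<n. entry k l) * \<eta> k"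
    and eq': "\<And>l. l < n \<Longrightarrow> (\<Sum>k<m. entry k l * \<eta> k) = z * (\<Sum>k<m. entry k l) * \<xi> l"
  shows "(\<Sum>k<m. (\<Sum>l<n. entry k l) * (\<eta> k - row_step z \<xi> (rb k))\<^sup>2)
    \<le> (p + g) * (2 * ((a + b) * p / (g\<^sup>2 * sqrt g) * (1 + 1 / \<zeta>) / \<zeta>))\<^sup>2 * \<theta>\<^sup>2"
proof -
  interpret T: block_perturbation n m b a cb rb "\<lambda>j i. P i j" "\<lambda>l k. w k l" p g \<theta> \<kappa>
    by (rule transpose)
  have TA: "T.entry l k = entry k l" for k l by (simp add: entry_def T.entry_def)
  have Tr: "T.row_step = col_step" "T.col_step = row_step"
    by (simp_all add: fun_eq_iff row_step_def col_step_def T.row_step_def T.col_step_def)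
  \<comment> \<open>The normalization is weighted by row sums, which are at least
    \<open>g * n\<close>; this bounds the unweighted norm.\<close>
  have "g * n * (\<Sum>k<m. (\<eta> k)\<^sup>2) \<le> (\<Sum>k<m. (\<Sum>l<n. entry k l) * (\<eta> k)\<^sup>2)"
    unfolding sum_distrib_left using row_ge by (intro sum_mono mult_right_mono) auto
  then have \<eta>': "(\<Sum>k<m. (\<eta> k)\<^sup>2) \<le> 1 / (g * n)"
    using \<eta> g n by (simp add: field_simps)
  have "g * m * (\<Sum>l<n. (\<xi> l)\<^sup>2) \<le> (\<Sum>l<n. (\<Sum>k<m. entry k l) * (\<xi> l)\<^sup>2)"
    unfolding sum_distrib_left using T.row_ge TA by (intro sum_mono mult_right_mono) auto
  then have \<xi>': "(\<Sum>l<n. (\<xi> l)\<^sup>2) \<le> 1 / (g * m)"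
    using \<xi> g m by (simp add: field_simps)
  define \<alpha> where "\<alpha> = sqrt n * L2_set (\<lambda>k. \<eta> k - row_step z \<xi> (rb k)) {..<m}"
  define \<beta> where "\<beta> = sqrt m * L2_set (\<lambda>l. \<xi> l - col_step z \<eta> (cb l)) {..<n}"
  \<comment> \<open>The part of the error of order \<open>\<theta>\<close> common to both sides;
    only the block counts \<open>b\<close> and \<open>a\<close> in front of it differ.\<close>
  define c where "c = p * \<theta> / (g\<^sup>2 * sqrt g) + p * \<theta> / (\<zeta> * g\<^sup>2 * sqrt g)"
  have c0: "0 \<le> c" unfolding c_def using p \<theta> g z by simp
  have \<alpha>0: "0 \<le> \<alpha>" and \<beta>0: "0 \<le> \<beta>" by (auto simp: \<alpha>_def \<beta>_def L2_set_nonneg)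
  have 1: "\<alpha> \<le> (b * c + \<kappa> / g * \<beta>) / \<zeta>"
    using row_residual_le[OF z \<eta>' \<xi>' eq] by (simp add: \<alpha>_def \<beta>_def c_def algebra_simps)
  have 2: "\<beta> \<le> (a * c + \<kappa> / g * \<alpha>) / \<zeta>"
    using T.row_residual_le[OF z \<xi>' \<eta>', unfolded TA Tr, OF eq']
    by (simp add: \<alpha>_def \<beta>_def c_def algebra_simps)
  have contr: "\<kappa> / g * x / \<zeta> \<le> x / 2" if "0 \<le> x" for x
  proof -
    have "\<kappa> / g * x / \<zeta> \<le> \<zeta> / 2 * x / \<zeta>"
      using that z by (intro divide_right_mono mult_right_mono[OF \<kappa>_small]) auto
    then show ?thesis using z by simp
  qed
  have "\<alpha> \<le> b * c / \<zeta> + \<beta> / 2" using 1 contr[OF \<beta>0] unfolding add_divide_distrib by linarith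
  moreover have "\<beta> \<le> a * c / \<zeta> + \<alpha> / 2" using 2 contr[OF \<alpha>0] unfolding add_divide_distrib by linarith
  moreover have "0 \<le> a * c / \<zeta>" "0 \<le> b * c / \<zeta>" using c0 z by simp_all
  \<comment> \<open>Inserting the second inequality into the first leaves
    \<open>\<alpha> / 4\<close> on the right, which is absorbed; the factor 2 is generous but
    symmetric in \<open>x\<close> and \<open>y\<close>.\<close>
  moreover have "\<alpha> \<le> 2 * (x + y)"
    if "\<alpha> \<le> y + \<beta> / 2" "\<beta> \<le> x + \<alpha> / 2" "0 \<le> x" "0 \<le> y" for x y :: real
    using that by argo
  ultimately have "\<alpha> \<le> 2 * (a * c / \<zeta> + b * c / \<zeta>)" by blast
  also have "\<dots> = 2 * ((a + b) * p / (g\<^sup>2 * sqrt g) * (1 + 1 / \<zeta>) / \<zeta>) * \<theta>"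
    using z g by (simp add: c_def field_simps)
  finally have \<alpha>_le: "\<alpha> \<le> 2 * ((a + b) * p / (g\<^sup>2 * sqrt g) * (1 + 1 / \<zeta>) / \<zeta>) * \<theta>" .
  have "(\<Sum>k<m. (\<Sum>l<n. entry k l) * (\<eta> k - row_step z \<xi> (rb k))\<^sup>2)
      \<le> (\<Sum>k<m. (p + g) * n * (\<eta> k - row_step z \<xi> (rb k))\<^sup>2)"
    using row_le by (intro sum_mono mult_right_mono) auto
  also have "\<dots> = (p + g) * \<alpha>\<^sup>2"
    by (simp add: \<alpha>_def power_mult_distrib L2_set_def sum_nonneg sum_distrib_left mult.assoc)
  also have "\<dots> \<le> (p + g) * (2 * ((a + b) * p / (g\<^sup>2 * sqrt g) * (1 + 1 / \<zeta>) / \<zeta>) * \<theta>)\<^sup>2"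
    using p g \<alpha>_le \<alpha>0 by (intro mult_left_mono power_mono) auto
  finally show ?thesis unfolding power_mult_distrib[of _ \<theta>] by (simp only: mult.assoc)
qed

end

section \<open>From singular vectors of the corresponding matrix to weighted variances\<close>

context block_perturbation
begin

text \<open>The columns of \<open>Y_corr\<close> and \<open>X_corr\<close> are the rescaled vectors
  \<open>\<eta> c\<close> and \<open>\<xi> c\<close>. Unit length of the singular vectors becomes
  normalization weighted by row and column sums, and the singular vector equations become those of
  \<open>row_step_approx\<close>, whose block values are used as centres.\<close>

lemma weighted_variance_corr_le:
  assumes Am: "Am \<in> carrier_mat m n" and entries: "\<And>k l. k < m \<Longrightarrow> l < n \<Longrightarrow> Am $$ (k, l) = entry k l"
    and surj: "\<And>i. i < a \<Longrightarrow> \<exists>k<m. rb k = i" "\<And>j. j < b \<Longrightarrow> \<exists>l<n. cb l = j"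
    and \<zeta>: "0 < \<zeta>" "\<kappa> / g \<le> \<zeta> / 2" and z: "\<And>i. i < r \<Longrightarrow> \<zeta> \<le> singular_values (corr Am) ! i"
    and top: "top_singular_vectors (corr Am) r ys xs"
  defines "e \<equiv> (p + g) * (2 * ((a + b) * p / (g\<^sup>2 * sqrt g) * (1 + 1 / \<zeta>) / \<zeta>))\<^sup>2 * \<theta>\<^sup>2"
  shows "weighted_variance (row_sum Am) a (Y_corr Am ys) \<le> r * e"
    and "weighted_variance (col_sum Am) b (X_corr Am xs) \<le> r * e"
proof -
  interpret T: block_perturbation n m b a cb rb "\<lambda>j i. P i j" "\<lambda>l k. w k l" p g \<theta> \<kappa>
    by (rule transpose)
  have TA: "T.entry l k = entry k l" for k l by (simp add: entry_def T.entry_def)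
  define D where "D k = (\<Sum>l<n. entry k l)" for k
  define E where "E l = (\<Sum>k<m. entry k l)" for l
  have D: "row_sum Am k = D k" if "k < m" for k
    using Am entries that by (simp add: row_sum_def D_def)
  have E: "col_sum Am l = E l" if "l < n" for l
    using Am entries that by (simp add: col_sum_def E_def)
  \<comment> \<open>Positivity of the sums excludes the degenerate conventions for
    \<open>1 / 0\<close> and roots of negative numbers in the correspondence transformation.\<close>
  have D0: "0 < D k" if "k < m" for k
  proof -
    have "0 < g * n" using g n by simp
    then show ?thesis using row_ge[OF that] by (simp add: D_def)
  qed
  have E0: "0 < E l" if "l < n" for l
  proof -
    have "0 < g * m" using g m by simp
    then show ?thesis using T.row_ge[OF that] by (simp add: E_def TA)
  qed
  have ne: "k < m \<Longrightarrow> D k \<noteq> 0" "l < n \<Longrightarrow> E l \<noteq> 0" for k l using D0[of k] E0[of l] by auto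
  have dims: "dim_row Am = m" "dim_col Am = n" using Am by auto
  have corr: "corr Am \<in> carrier_mat m n"
    using mult_carrier_mat[OF mult_carrier_mat[OF mat_diag_dim Am] mat_diag_dim]
    by (simp add: corr_def inv_sqrt_Drow_def inv_sqrt_Dcol_def dims)
  have corr_entry: "corr Am $$ (k, l) = entry k l / (sqrt (D k) * sqrt (E l))" if "k < m" "l < n" for k l
    using Am that unfolding corr_def inv_sqrt_Drow_def inv_sqrt_Dcol_def dims
    by (simp add: mat_diag_mult_left[of _ m n] mat_diag_mult_right[of _ m n] entries D E)
  have len: "length ys = r" "length xs = r" using top by (auto simp: top_singular_vectors_def)
  define \<eta> where "\<eta> c k = vec_index (ys ! c) k / sqrt (D k)" for c k
  define \<xi> where "\<xi> c l = vec_index (xs ! c) l / sqrt (E l)" for c l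
  let ?z = "\<lambda>c. singular_values (corr Am) ! c"
  have vecs: "ys ! c \<in> carrier_vec m" "xs ! c \<in> carrier_vec n" if "c < r" for c
    using top that corr unfolding top_singular_vectors_def orthonormal_vecs_def
    by (auto simp: subset_iff)
  have y_eq: "vec_index (ys ! c) k = sqrt (D k) * \<eta> c k" if "k < m" for c k
    using D0[OF that] by (simp add: \<eta>_def)
  have x_eq: "vec_index (xs ! c) l = sqrt (E l) * \<xi> c l" if "l < n" for c l
    using E0[OF that] by (simp add: \<xi>_def)
  have rows: "(\<Sum>l<n. entry k l * \<xi> c l) = ?z c * (\<Sum>l<n. entry k l) * \<eta> c k" if c: "c < r" and k: "k < m" for c k
  proof -
    have "vec_index (corr Am *\<^sub>v (xs ! c)) k = vec_index (?z c \<cdot>\<^sub>v (ys ! c)) k"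
      using top c by (simp add: top_singular_vectors_def)
    then have "(\<Sum>l<n. corr Am $$ (k, l) * vec_index (xs ! c) l) = ?z c * vec_index (ys ! c) k"
      using vecs[OF c] k corr by (simp add: scalar_prod_def lessThan_atLeast0)
    moreover have "(\<Sum>l<n. corr Am $$ (k, l) * vec_index (xs ! c) l) = (\<Sum>l<n. entry k l * \<xi> c l / sqrt (D k))"
      using k by (intro sum.cong refl) (simp add: corr_entry x_eq ne)
    ultimately have "(\<Sum>l<n. entry k l * \<xi> c l) / sqrt (D k) = ?z c * (sqrt (D k) * \<eta> c k)"
      by (simp add: sum_divide_distrib y_eq k)
    then have "(\<Sum>l<n. entry k l * \<xi> c l) = ?z c * (sqrt (D k) * sqrt (D k)) * \<eta> c k"
      using D0[OF k] by (simp add: divide_eq_eq mult_ac)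
    then show ?thesis using D0[OF k] by (simp add: D_def)
  qed
  have cols: "(\<Sum>k<m. entry k l * \<eta> c k) = ?z c * (\<Sum>k<m. entry k l) * \<xi> c l" if c: "c < r" and l: "l < n" for c l
  proof -
    have "vec_index (transpose_mat (corr Am) *\<^sub>v (ys ! c)) l = vec_index (?z c \<cdot>\<^sub>v (xs ! c)) l"
      using top c by (simp add: top_singular_vectors_def)
    then have "(\<Sum>k<m. corr Am $$ (k, l) * vec_index (ys ! c) k) = ?z c * vec_index (xs ! c) l"
      using vecs[OF c] l corr by (simp add: scalar_prod_def lessThan_atLeast0)
    moreover have "(\<Sum>k<m. corr Am $$ (k, l) * vec_index (ys ! c) k) = (\<Sum>k<m. entry k l * \<eta> c k / sqrt (E l))"
      using l by (intro sum.cong refl) (simp add: corr_entry y_eq ne)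
    ultimately have "(\<Sum>k<m. entry k l * \<eta> c k) / sqrt (E l) = ?z c * (sqrt (E l) * \<xi> c l)"
      by (simp add: sum_divide_distrib x_eq l)
    then have "(\<Sum>k<m. entry k l * \<eta> c k) = ?z c * (sqrt (E l) * sqrt (E l)) * \<xi> c l"
      using E0[OF l] by (simp add: divide_eq_eq mult_ac)
    then show ?thesis using E0[OF l] by (simp add: E_def)
  qed
  have norm_y: "(\<Sum>k<m. (\<Sum>l<n. entry k l) * (\<eta> c k)\<^sup>2) = 1" if c: "c < r" for c
  proof -
    have "1 = scalar_prod (ys ! c) (ys ! c)"
      using top c len unfolding top_singular_vectors_def orthonormal_vecs_def by auto
    also have "\<dots> = (\<Sum>k<m. vec_index (ys ! c) k * vec_index (ys ! c) k)"
      using vecs[OF c] by (simp add: scalar_prod_def lessThan_atLeast0)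
    also have "\<dots> = (\<Sum>k<m. D k * (\<eta> c k)\<^sup>2)"
    proof (intro sum.cong refl)
      fix k assume "k \<in> {..<m}"
      then have "sqrt (D k) * sqrt (D k) = D k" using D0[of k] by simp
      then show "vec_index (ys ! c) k * vec_index (ys ! c) k = D k * (\<eta> c k)\<^sup>2"
        using y_eq[of k c] \<open>k \<in> _\<close> by (simp add: power2_eq_square)
    qed
    finally show ?thesis by (simp add: D_def)
  qed
  have norm_x: "(\<Sum>l<n. (\<Sum>k<m. entry k l) * (\<xi> c l)\<^sup>2) = 1" if c: "c < r" for c
  proof -
    have "1 = scalar_prod (xs ! c) (xs ! c)"
      using top c len unfolding top_singular_vectors_def orthonormal_vecs_def by auto
    also have "\<dots> = (\<Sum>l<n. vec_index (xs ! c) l * vec_index (xs ! c) l)"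
      using vecs[OF c] by (simp add: scalar_prod_def lessThan_atLeast0)
    also have "\<dots> = (\<Sum>l<n. E l * (\<xi> c l)\<^sup>2)"
    proof (intro sum.cong refl)
      fix l assume "l \<in> {..<n}"
      then have "sqrt (E l) * sqrt (E l) = E l" using E0[of l] by simp
      then show "vec_index (xs ! c) l * vec_index (xs ! c) l = E l * (\<xi> c l)\<^sup>2"
        using x_eq[of l c] \<open>l \<in> _\<close> by (simp add: power2_eq_square)
    qed
    finally show ?thesis by (simp add: E_def)
  qed
  have Y: "Y_corr Am ys \<in> carrier_mat m r" by (intro carrier_matI) (simp_all add: Y_corr_def dims len)
  have X: "X_corr Am xs \<in> carrier_mat n r" by (intro carrier_matI) (simp_all add: X_corr_def dims len)
  have Y_entry: "Y_corr Am ys $$ (k, c) = \<eta> c k" if "k < m" "c < r" for k c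
    using that vecs[OF that(2)] D
    by (simp add: Y_corr_def dims len mat_of_cols_index inv_sqrt_Drow_def \<eta>_def mat_diag_def
        scalar_prod_def if_distrib[of "\<lambda>x. x * _"] sum.delta cong: if_cong)
  have X_entry: "X_corr Am xs $$ (l, c) = \<xi> c l" if "l < n" "c < r" for l c
    using that vecs[OF that(2)] E
    by (simp add: X_corr_def dims len mat_of_cols_index inv_sqrt_Dcol_def \<xi>_def mat_diag_def
        scalar_prod_def if_distrib[of "\<lambda>x. x * _"] sum.delta cong: if_cong)
  show "weighted_variance (row_sum Am) a (Y_corr Am ys) \<le> r * e"
  proof (rule weighted_variance_le[OF Y, where blk = rb and t = "\<lambda>c. row_step (?z c) (\<xi> c)"])
    fix c assume c: "c < r"
    have "(\<Sum>k<m. row_sum Am k * (Y_corr Am ys $$ (k, c) - row_step (?z c) (\<xi> c) (rb k))\<^sup>2)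
        = (\<Sum>k<m. (\<Sum>l<n. entry k l) * (\<eta> c k - row_step (?z c) (\<xi> c) (rb k))\<^sup>2)"
      by (intro sum.cong refl) (simp add: D Y_entry c D_def)
    also have "\<dots> \<le> e" unfolding e_def
      using c by (intro row_step_approx z \<zeta> norm_y norm_x rows cols)
    finally show "(\<Sum>k<m. row_sum Am k * (Y_corr Am ys $$ (k, c) - row_step (?z c) (\<xi> c) (rb k))\<^sup>2) \<le> e" .
  qed (use D D0 rb surj in auto)
  show "weighted_variance (col_sum Am) b (X_corr Am xs) \<le> r * e"
  \<comment> \<open>The column side is the row side of the transposed locale; its constant has
    \<open>b + a\<close> in place of \<open>a + b\<close>.\<close>
  proof (rule weighted_variance_le[OF X, where blk = cb and t = "\<lambda>c. T.row_step (?z c) (\<eta> c)"])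
    fix c assume c: "c < r"
    have "(\<Sum>l<n. col_sum Am l * (X_corr Am xs $$ (l, c) - T.row_step (?z c) (\<eta> c) (cb l))\<^sup>2)
        = (\<Sum>l<n. (\<Sum>k<m. T.entry l k) * (\<xi> c l - T.row_step (?z c) (\<eta> c) (cb l))\<^sup>2)"
      by (intro sum.cong refl) (simp add: E X_entry c E_def TA)
    also have "\<dots> \<le> (p + g) * (2 * ((b + a) * p / (g\<^sup>2 * sqrt g) * (1 + 1 / \<zeta>) / \<zeta>))\<^sup>2 * \<theta>\<^sup>2"
      using c by (intro T.row_step_approx z \<zeta>) (simp_all add: TA norm_y norm_x rows cols)
    also have "\<dots> = e" by (simp add: e_def add.commute)
    finally show "(\<Sum>l<n. col_sum Am l * (X_corr Am xs $$ (l, c) - T.row_step (?z c) (\<eta> c) (cb l))\<^sup>2) \<le> e" .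
  qed (use E E0 cb surj in auto)
qed

end

text \<open>The properties of a single realization from which the deterministic bounds follow. The
  exponent exceeds the natural scale 1/2 by \<open>h\<close>, which makes the exceptional
  probabilities decay like \<open>exp (- \<kappa> * n powr (2 * h))\<close> for a constant
  \<open>\<kappa> > 0\<close>.\<close>

definition regular_noise ::
  "real \<Rightarrow> real \<Rightarrow> nat \<Rightarrow> nat \<Rightarrow> (nat \<Rightarrow> nat) \<Rightarrow> (nat \<Rightarrow> nat) \<Rightarrow> nat \<Rightarrow> nat \<Rightarrow> real mat \<Rightarrow> bool" where
  "regular_noise K h a b rb cb m n X \<longleftrightarrow>
      (\<forall>k<m. \<forall>l<n. \<bar>X $$ (k, l)\<bar> \<le> K) \<and>
      (\<forall>k<m. \<forall>j<b. \<bar>\<Sum>l | l < n \<and> cb l = j. X $$ (k, l)\<bar> \<le> n powr (1 / 2 + h)) \<and>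
      (\<forall>l<n. \<forall>i<a. \<bar>\<Sum>k | k < m \<and> rb k = i. X $$ (k, l)\<bar> \<le> m powr (1 / 2 + h)) \<and>
      (\<forall>k<m. \<forall>k'<m. k \<noteq> k' \<longrightarrow>
         \<bar>\<Sum>l<n. X $$ (k, l) * X $$ (k', l)\<bar> \<le> n powr (1 / 2 + h))"

section \<open>Wigner-noise\<close>

context prob_space
begin

text \<open>Having \<open>N\<close> instead of \<open>card S\<close> in the exponent gives one bound
  for all blocks of a row or column, whatever their sizes.\<close>

lemma Hoeffding_centered_sum:
  fixes X :: "'i \<Rightarrow> 'a \<Rightarrow> real"
  assumes S: "finite S" "card S \<le> N" and indep: "indep_vars (\<lambda>_. borel) X S"
    and bound: "\<And>i. i \<in> S \<Longrightarrow> AE \<omega> in M. \<bar>X i \<omega>\<bar> \<le> L" and L: "0 < L"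
    and mean: "\<And>i. i \<in> S \<Longrightarrow> expectation (X i) = 0" and t: "0 \<le> t"
  shows "prob {\<omega>\<in>space M. t \<le> \<bar>\<Sum>i\<in>S. X i \<omega>\<bar>} \<le> 2 * exp (- t\<^sup>2 / (2 * L\<^sup>2 * N))"
proof (cases "S = {}")
  case True
  \<comment> \<open>The empty sum is 0: for \<open>t = 0\<close> the event is the whole space and
    the bound is 2, for positive \<open>t\<close> the event is empty.\<close>
  then show ?thesis using t prob_space by (cases "t = 0") auto
next
  case False
  interpret Hoeffding_ineq M S X "\<lambda>_. - L" "\<lambda>_. L" 0
  proof unfold_locales
    show "AE \<omega> in M. X i \<omega> \<in> {- L..L}" if "i \<in> S" for i
      using bound[OF that] by eventually_elim auto
  qed (use S indep mean in auto)
  have c: "0 < card S" using False S by (simp add: card_gt_0_iff)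
  have "prob {\<omega>\<in>space M. t \<le> \<bar>\<Sum>i\<in>S. X i \<omega>\<bar>} \<le> 2 * exp (- 2 * t\<^sup>2 / (\<Sum>i\<in>S. (L - - L)\<^sup>2))"
    using Hoeffding_ineq_abs_ge[OF t] c L by simp
  also have "(\<Sum>i\<in>S. (L - - L)\<^sup>2) = 4 * L\<^sup>2 * card S" by (simp add: power2_eq_square)
  also have "- 2 * t\<^sup>2 / (4 * L\<^sup>2 * card S) = - (t\<^sup>2 / (2 * L\<^sup>2 * card S))" by simp
  also have "t\<^sup>2 / (2 * L\<^sup>2 * N) \<le> t\<^sup>2 / (2 * L\<^sup>2 * card S)"
    using c L S by (intro divide_left_mono mult_left_mono) auto
  then have "2 * exp (- (t\<^sup>2 / (2 * L\<^sup>2 * card S))) \<le> 2 * exp (- t\<^sup>2 / (2 * L\<^sup>2 * N))" by simp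
  finally show ?thesis .
qed

text \<open>Injectivity makes the singletons \<open>{f j}\<close> disjoint, so this is a case of
  grouping independent variables.\<close>

lemma indep_vars_reindex_inj:
  assumes ind: "indep_vars (\<lambda>_. N) X I" and f: "inj_on f S" "f ` S \<subseteq> I"
  shows "indep_vars (\<lambda>_. N) (\<lambda>i. X (f i)) S"
proof -
  have "indep_vars (\<lambda>j. PiM {f j} (\<lambda>_. N)) (\<lambda>j \<omega>. restrict (\<lambda>i. X i \<omega>) {f j}) S"
    using f by (intro indep_vars_restrict[OF ind]) (auto simp: disjoint_family_on_def inj_on_def)
  then have "indep_vars (\<lambda>_. N) (\<lambda>j \<omega>. (\<lambda>g. g (f j)) (restrict (\<lambda>i. X i \<omega>) {f j})) S"
    by (rule indep_vars_compose2) simp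
  then show ?thesis by simp
qed

text \<open>Products in different columns depend on disjoint groups of entries. This makes
  Hoeffding's inequality applicable to inner products of two rows.\<close>

lemma indep_vars_row_products:
  fixes X :: "'i \<times> 'j \<Rightarrow> 'a \<Rightarrow> real"
  assumes ind: "indep_vars (\<lambda>_. borel) X (A \<times> B)" and k: "k \<in> A" "k' \<in> A"
  shows "indep_vars (\<lambda>_. borel) (\<lambda>l \<omega>. X (k, l) \<omega> * X (k', l) \<omega>) B"
proof -
  let ?K = "\<lambda>l. {(k, l), (k', l)}"
  have "indep_vars (\<lambda>l. PiM (?K l) (\<lambda>_. borel)) (\<lambda>l \<omega>. restrict (\<lambda>i. X i \<omega>) (?K l)) B"
    using k by (intro indep_vars_restrict[OF ind]) (auto simp: disjoint_family_on_def)
  then have "indep_vars (\<lambda>_. borel)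
      (\<lambda>l \<omega>. (\<lambda>g. g (k, l) * g (k', l)) (restrict (\<lambda>i. X i \<omega>) (?K l))) B"
    by (rule indep_vars_compose2) (intro borel_measurable_times; simp)
  then show ?thesis by simp
qed

lemma prob_ex_le:
  fixes e :: real
  assumes I: "finite I" and meas: "\<And>i. i \<in> I \<Longrightarrow> {\<omega>\<in>space M. Q i \<omega>} \<in> events"
    and le: "\<And>i. i \<in> I \<Longrightarrow> prob {\<omega>\<in>space M. Q i \<omega>} \<le> e"
  shows "prob {\<omega>\<in>space M. \<exists>i\<in>I. Q i \<omega>} \<le> card I * e"
proof -
  have "{\<omega>\<in>space M. \<exists>i\<in>I. Q i \<omega>} = (\<Union>i\<in>I. {\<omega>\<in>space M. Q i \<omega>})" by auto
  also have "prob \<dots> \<le> (\<Sum>i\<in>I. prob {\<omega>\<in>space M. Q i \<omega>})"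
    using I meas by (intro finite_measure_subadditive_finite) auto
  also have "\<dots> \<le> (\<Sum>i\<in>I. e)" by (intro sum_mono le)
  finally show ?thesis by simp
qed

text \<open>The off-diagonal entries of the Gram matrix of the rows are included because they yield a bound
  on the operator norm.\<close>

lemma wigner_noise_deviation:
  fixes a b :: nat and rb cb :: "nat \<Rightarrow> nat"
  assumes W: "wigner_noise M K m n W" and K: "0 < K" and t: "0 \<le> t" "0 \<le> t'"
  shows "\<exists>E\<in>events. prob E \<le> 2 * (m * b + m * m) * exp (- t\<^sup>2 / (2 * (K + K\<^sup>2)\<^sup>2 * n))
            + 2 * (n * a) * exp (- t'\<^sup>2 / (2 * (K + K\<^sup>2)\<^sup>2 * m)) \<and>
    (\<forall>\<omega>\<in>space M - E.
      (\<forall>k<m. \<forall>j<b. \<bar>\<Sum>l | l < n \<and> cb l = j. W \<omega> $$ (k, l)\<bar> \<le> t) \<and>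
      (\<forall>l<n. \<forall>i<a. \<bar>\<Sum>k | k < m \<and> rb k = i. W \<omega> $$ (k, l)\<bar> \<le> t') \<and>
      (\<forall>k<m. \<forall>k'<m. k \<noteq> k' \<longrightarrow> \<bar>\<Sum>l<n. W \<omega> $$ (k, l) * W \<omega> $$ (k', l)\<bar> \<le> t))"
proof -
  define X where "X ij \<omega> = W \<omega> $$ ij" for ij \<omega>
  \<comment> \<open>One constant bounding both the entries, by \<open>K\<close>, and the products of
    two entries, by \<open>K\<^sup>2\<close>.\<close>
  define L where "L = K + K\<^sup>2"
  have L: "0 < L" "K \<le> L" "K\<^sup>2 \<le> L" using K by (auto simp: L_def intro: add_pos_pos)
  have ind: "indep_vars (\<lambda>_. borel) X ({..<m} \<times> {..<n})"
    using W unfolding wigner_noise_def X_def by simp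
  have rv: "X (k, l) \<in> borel_measurable M" if "k < m" "l < n" for k l
    using ind that unfolding indep_vars_def by auto
  have mean: "expectation (X (k, l)) = 0" and bound: "AE \<omega> in M. \<bar>X (k, l) \<omega>\<bar> \<le> K"
    if "k < m" "l < n" for k l
    using W that unfolding wigner_noise_def X_def by auto
  \<comment> \<open>The bad events are strict so that their complements give the bounds with \<le>;
    Hoeffding's inequality is applied to the larger non-strict events.\<close>
  define R where "R = (\<lambda>(k, j) \<omega>. t < \<bar>\<Sum>l | l < n \<and> cb l = j. X (k, l) \<omega>\<bar>)"
  define C where "C = (\<lambda>(l, i) \<omega>. t' < \<bar>\<Sum>k | k < m \<and> rb k = i. X (k, l) \<omega>\<bar>)"
  define G where "G = (\<lambda>(k, k') \<omega>. k \<noteq> k' \<and> t < \<bar>\<Sum>l<n. X (k, l) \<omega> * X (k', l) \<omega>\<bar>)"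
  define ER where "ER = {\<omega>\<in>space M. \<exists>i\<in>{..<m}\<times>{..<b}. R i \<omega>}"
  define EC where "EC = {\<omega>\<in>space M. \<exists>i\<in>{..<n}\<times>{..<a}. C i \<omega>}"
  define EG where "EG = {\<omega>\<in>space M. \<exists>i\<in>{..<m}\<times>{..<m}. G i \<omega>}"
  let ?e = "2 * exp (- t\<^sup>2 / (2 * L\<^sup>2 * n))" and ?e' = "2 * exp (- t'\<^sup>2 / (2 * L\<^sup>2 * m))"
  have weak: "AE \<omega> in M. \<bar>X (k, l) \<omega>\<bar> \<le> L" if "k < m" "l < n" for k l
    using bound[OF that] by eventually_elim (use L in auto)
  have Rm: "{\<omega>\<in>space M. R i \<omega>} \<in> events" if "i \<in> {..<m}\<times>{..<b}" for i
    using that rv unfolding R_def by (auto simp: split_beta intro!: borel_measurable_less borel_measurable_sum borel_measurable_abs)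
  have Cm: "{\<omega>\<in>space M. C i \<omega>} \<in> events" if "i \<in> {..<n}\<times>{..<a}" for i
    using that rv unfolding C_def by (auto simp: split_beta intro!: borel_measurable_less borel_measurable_sum borel_measurable_abs)
  have Gm: "{\<omega>\<in>space M. G i \<omega>} \<in> events" if "i \<in> {..<m}\<times>{..<m}" for i
  proof (cases "fst i = snd i")
    case False
    then show ?thesis using that rv unfolding G_def
      by (auto simp: split_beta intro!: borel_measurable_less borel_measurable_sum borel_measurable_abs borel_measurable_times)
  qed (simp add: G_def split_beta)
  have Rp: "prob {\<omega>\<in>space M. R i \<omega>} \<le> ?e" if "i \<in> {..<m}\<times>{..<b}" for i
  proof -
    obtain k j where i: "i = (k, j)" and k: "k < m" using \<open>i \<in> _\<close> by auto
    have ms: "{\<omega>\<in>space M. t \<le> \<bar>\<Sum>l | l < n \<and> cb l = j. X (k, l) \<omega>\<bar>} \<in> events"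
      using k rv by (auto intro!: borel_measurable_le borel_measurable_sum borel_measurable_abs)
    have "prob {\<omega>\<in>space M. R i \<omega>} \<le> prob {\<omega>\<in>space M. t \<le> \<bar>\<Sum>l | l < n \<and> cb l = j. X (k, l) \<omega>\<bar>}"
      using ms by (intro finite_measure_mono) (auto simp: R_def i)
    also have "\<dots> \<le> ?e"
    proof (rule Hoeffding_centered_sum)
      show "card {l. l < n \<and> cb l = j} \<le> n"
        using card_mono[of "{..<n}" "{l. l < n \<and> cb l = j}"] by auto
      show "indep_vars (\<lambda>_. borel) (\<lambda>l. X (k, l)) {l. l < n \<and> cb l = j}"
        using k by (intro indep_vars_reindex_inj[OF ind]) (auto simp: inj_on_def)
    qed (use k weak mean L t in auto)
    finally show ?thesis .
  qed
  have Cp: "prob {\<omega>\<in>space M. C i \<omega>} \<le> ?e'" if "i \<in> {..<n}\<times>{..<a}" for i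
  proof -
    obtain l j where i: "i = (l, j)" and l: "l < n" using \<open>i \<in> _\<close> by auto
    have ms: "{\<omega>\<in>space M. t' \<le> \<bar>\<Sum>k | k < m \<and> rb k = j. X (k, l) \<omega>\<bar>} \<in> events"
      using l rv by (auto intro!: borel_measurable_le borel_measurable_sum borel_measurable_abs)
    have "prob {\<omega>\<in>space M. C i \<omega>} \<le> prob {\<omega>\<in>space M. t' \<le> \<bar>\<Sum>k | k < m \<and> rb k = j. X (k, l) \<omega>\<bar>}"
      using ms by (intro finite_measure_mono) (auto simp: C_def i)
    also have "\<dots> \<le> ?e'"
    proof (rule Hoeffding_centered_sum)
      show "card {k. k < m \<and> rb k = j} \<le> m"
        using card_mono[of "{..<m}" "{k. k < m \<and> rb k = j}"] by auto
      show "indep_vars (\<lambda>_. borel) (\<lambda>k. X (k, l)) {k. k < m \<and> rb k = j}"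
        using l by (intro indep_vars_reindex_inj[OF ind]) (auto simp: inj_on_def)
    qed (use l weak mean L t in auto)
    finally show ?thesis .
  qed
  have Gp: "prob {\<omega>\<in>space M. G i \<omega>} \<le> ?e" if "i \<in> {..<m}\<times>{..<m}" for i
  proof -
    obtain k k' where i: "i = (k, k')" and k: "k < m" "k' < m" using \<open>i \<in> _\<close> by auto
    show ?thesis
    proof (cases "k = k'")
      case False
      have ms: "{\<omega>\<in>space M. t \<le> \<bar>\<Sum>l<n. X (k, l) \<omega> * X (k', l) \<omega>\<bar>} \<in> events"
        using k rv by (auto intro!: borel_measurable_le borel_measurable_sum borel_measurable_abs borel_measurable_times)
      have "prob {\<omega>\<in>space M. G i \<omega>} \<le> prob {\<omega>\<in>space M. t \<le> \<bar>\<Sum>l<n. X (k, l) \<omega> * X (k', l) \<omega>\<bar>}"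
        using ms by (intro finite_measure_mono) (auto simp: G_def i)
      also have "\<dots> \<le> ?e"
      proof (rule Hoeffding_centered_sum)
        show "indep_vars (\<lambda>_. borel) (\<lambda>l \<omega>. X (k, l) \<omega> * X (k', l) \<omega>) {..<n}"
          using k by (intro indep_vars_row_products[OF ind]) auto
        show "AE \<omega> in M. \<bar>X (k, l) \<omega> * X (k', l) \<omega>\<bar> \<le> L" if "l \<in> {..<n}" for l
        proof -
          have l: "l < n" using that by simp
          show ?thesis using bound[OF k(1) l] bound[OF k(2) l]
          proof eventually_elim
            case (elim \<omega>)
            then have "\<bar>X (k, l) \<omega>\<bar> * \<bar>X (k', l) \<omega>\<bar> \<le> K * K"
              using K by (intro mult_mono) auto
            then show ?case using L by (simp add: abs_mult power2_eq_square)
          qed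
        qed
        show "expectation (\<lambda>\<omega>. X (k, l) \<omega> * X (k', l) \<omega>) = 0" if "l \<in> {..<n}" for l
        proof -
          have l: "l < n" using that by simp
          have int: "integrable M (X ij)" if "ij \<in> {(k, l), (k', l)}" for ij
            using that k l bound[of "fst ij" "snd ij"] rv[of "fst ij" "snd ij"]
            by (intro integrable_const_bound[where B = K]) auto
          \<comment> \<open>Writing the product over a two-element index set lets independence
            factor the expectation; the two indices differ because
            \<open>k \<noteq> k'\<close>.\<close>
          have "expectation (\<lambda>\<omega>. \<Prod>ij\<in>{(k, l), (k', l)}. X ij \<omega>) = (\<Prod>ij\<in>{(k, l), (k', l)}. expectation (X ij))"
            using k l int by (intro indep_vars_lebesgue_integral indep_vars_subset[OF ind]) auto
          then show ?thesis using False mean[OF k(1) l] by simp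
        qed
      qed (use L t in auto)
      finally show ?thesis .
    qed (simp add: i G_def)
  qed
  show ?thesis
  proof (intro bexI conjI ballI)
    show ev: "ER \<union> EC \<union> EG \<in> events"
      unfolding ER_def EC_def EG_def using Rm Cm Gm by (intro sets.Un sets.sets_Collect_finite_Ex) auto
    have "prob (ER \<union> EC \<union> EG) \<le> (prob ER + prob EC) + prob EG"
      by (intro order_trans[OF measure_Un_le] add_right_mono measure_Un_le)
        (auto simp: ER_def EC_def EG_def intro!: sets.Un sets.sets_Collect_finite_Ex Rm Cm Gm)
    moreover have "prob ER \<le> (m * b) * ?e" "prob EC \<le> (n * a) * ?e'" "prob EG \<le> (m * m) * ?e"
      using prob_ex_le[of "{..<m}\<times>{..<b}" R, OF _ Rm Rp] prob_ex_le[of "{..<n}\<times>{..<a}" C, OF _ Cm Cp]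
        prob_ex_le[of "{..<m}\<times>{..<m}" G, OF _ Gm Gp]
      unfolding ER_def EC_def EG_def by (simp_all add: card_cartesian_product)
    ultimately show "prob (ER \<union> EC \<union> EG) \<le> 2 * (m * b + m * m) * exp (- t\<^sup>2 / (2 * (K + K\<^sup>2)\<^sup>2 * n))
            + 2 * (n * a) * exp (- t'\<^sup>2 / (2 * (K + K\<^sup>2)\<^sup>2 * m))"
      by (simp add: L_def algebra_simps)
  next
    fix \<omega> assume "\<omega> \<in> space M - (ER \<union> EC \<union> EG)"
    then have *: "\<forall>k<m. \<forall>j<b. \<not> R (k, j) \<omega>" "\<forall>l<n. \<forall>i<a. \<not> C (l, i) \<omega>" "\<forall>k<m. \<forall>k'<m. \<not> G (k, k') \<omega>"
      by (auto simp: ER_def EC_def EG_def)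
    show "\<forall>k<m. \<forall>j<b. \<bar>\<Sum>l | l < n \<and> cb l = j. W \<omega> $$ (k, l)\<bar> \<le> t"
      using *(1) by (simp add: R_def X_def not_less)
    show "\<forall>l<n. \<forall>i<a. \<bar>\<Sum>k | k < m \<and> rb k = i. W \<omega> $$ (k, l)\<bar> \<le> t'"
      using *(2) by (simp add: C_def X_def not_less)
    show "\<forall>k<m. \<forall>k'<m. k \<noteq> k' \<longrightarrow> \<bar>\<Sum>l<n. W \<omega> $$ (k, l) * W \<omega> $$ (k', l)\<bar> \<le> t"
      using *(3) by (auto simp: G_def X_def not_less)
  qed
qed

section \<open>Almost sure bounds over all sizes\<close>

text \<open>The product bound is summable over all pairs, so along the enumeration
  \<open>prod_decode\<close> almost surely only finitely many bad events occur. A code dominates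
  both of its coordinates, hence large sizes have large codes.\<close>

lemma borel_cantelli_pairs:
  fixes E :: "nat \<Rightarrow> nat \<Rightarrow> 'a set"
  assumes E: "\<And>m n. (m, n) \<in> J \<Longrightarrow> N \<le> m \<Longrightarrow> N \<le> n \<Longrightarrow> E m n \<in> events"
    and le: "\<And>m n. (m, n) \<in> J \<Longrightarrow> N \<le> m \<Longrightarrow> N \<le> n \<Longrightarrow> prob (E m n) \<le> 1 / (real m ^ 2 * real n ^ 2)"
  shows "AE \<omega> in M. \<exists>m0 n0. \<forall>m\<ge>m0. \<forall>n\<ge>n0. (m, n) \<in> J \<longrightarrow> \<omega> \<notin> E m n"
proof -
  \<comment> \<open>Outside \<open>J\<close> and below \<open>N\<close> nothing is assumed about
    \<open>E\<close>; there the event is replaced by the empty one.\<close>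
  define F where "F p = (if p \<in> J \<and> N \<le> fst p \<and> N \<le> snd p then E (fst p) (snd p) else {})" for p
  define f where "f m = 1 / real m ^ 2" for m
  have sf: "summable f" unfolding f_def using inverse_power_summable[of 2, where 'a = real]
    by (simp add: inverse_eq_divide)
  have f0: "0 \<le> f m" for m by (simp add: f_def)
  have F: "F p \<in> events" for p using E[of "fst p" "snd p"] by (simp add: F_def)
  have Fle: "prob (F p) \<le> f (fst p) * f (snd p)" for p
    using le[of "fst p" "snd p"] f0 by (simp add: F_def f_def)
  have "summable (\<lambda>k. prob (F (prod_decode k)))"
  proof (rule summableI_nonneg_bounded)
    fix k
    have "(\<Sum>i<k. prob (F (prod_decode i))) = (\<Sum>p\<in>prod_decode ` {..<k}. prob (F p))"
      by (simp add: sum.reindex[OF inj_on_subset[OF inj_prod_decode subset_UNIV]])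
    also have "\<dots> \<le> (\<Sum>p\<in>prod_decode ` {..<k}. f (fst p) * f (snd p))" by (intro sum_mono Fle)
    \<comment> \<open>Pairs with code below \<open>k\<close> lie in a square, over which the sum
      factorizes.\<close>
    also have "\<dots> \<le> (\<Sum>p\<in>{..<k}\<times>{..<k}. f (fst p) * f (snd p))"
    proof (rule sum_mono2)
      show "prod_decode ` {..<k} \<subseteq> {..<k} \<times> {..<k}"
      proof
        fix p assume "p \<in> prod_decode ` {..<k}"
        then have "prod_encode p < k" by auto
        then show "p \<in> {..<k} \<times> {..<k}"
          using le_prod_encode_1[of "fst p" "snd p"] le_prod_encode_2[of "snd p" "fst p"]
          by (cases p) auto
      qed
    qed (auto simp: f0)
    also have "\<dots> = (\<Sum>i<k. f i) * (\<Sum>i<k. f i)"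
      by (simp add: sum_product sum.cartesian_product split_beta)
    also have "\<dots> \<le> suminf f * suminf f"
      using sf f0 by (intro mult_mono sum_le_suminf sum_nonneg suminf_nonneg) auto
    finally show "(\<Sum>i<k. prob (F (prod_decode i))) \<le> suminf f * suminf f" .
  qed simp
  then have "AE \<omega> in M. eventually (\<lambda>k. \<omega> \<in> space M - F (prod_decode k)) sequentially"
    using F by (intro borel_cantelli_AE1) (auto simp: emeasure_eq_measure)
  then show ?thesis
  proof eventually_elim
    case (elim \<omega>)
    then obtain k where k: "\<And>i. k \<le> i \<Longrightarrow> \<omega> \<notin> F (prod_decode i)"
      by (auto simp: eventually_sequentially)
    have "\<omega> \<notin> E m n" if "max k N \<le> m" "max k N \<le> n" "(m, n) \<in> J" for m n
    proof -
      have "k \<le> prod_encode (m, n)" using that le_prod_encode_1[of m n] by simp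
      from k[OF this] show ?thesis using that by (simp add: F_def)
    qed
    then show ?case by blast
  qed
qed

end

text \<open>The stretched exponential beats every power. The base \<open>C0 * x powr C\<close>
  stands for the bound that GC2 gives on the other dimension.\<close>

lemma eventually_poly_exp_small:
  fixes C :: real
  assumes "0 < \<kappa>" "0 < h" "0 < C0" "1 \<le> C" "0 \<le> c"
  shows "eventually (\<lambda>x. c * (C0 * real x powr C) ^ 4 * real x ^ 2 * exp (- \<kappa> * real x powr (2 * h)) \<le> 1 / 2) sequentially"
proof -
  have "((\<lambda>x. c * (C0 * real x powr C) ^ 4 * real x ^ 2 * exp (- \<kappa> * real x powr (2 * h))) \<longlongrightarrow> 0) sequentially"
    using assms by real_asymp
  then have "eventually (\<lambda>x. c * (C0 * real x powr C) ^ 4 * real x ^ 2 * exp (- \<kappa> * real x powr (2 * h)) < 1 / 2) sequentially"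
    by (rule order_tendstoD) simp
  then show ?thesis by (rule eventually_mono) simp
qed

text \<open>At deviation level \<open>n powr (1 / 2 + h)\<close> the Hoeffding bound decays faster
  than any power of \<open>n\<close>. By GC2 it also absorbs powers of \<open>m\<close>, and
  symmetrically with the roles exchanged, so the total is at most \<open>1 / (m^2 * n^2)\<close> for
  large sizes.\<close>

lemma (in prob_space) wigner_noise_almost_surely:
  fixes a b :: nat and rb cb :: "nat \<Rightarrow> nat \<Rightarrow> nat \<Rightarrow> nat"
  assumes K: "0 < K" and noise: "\<forall>(m, n)\<in>J. wigner_noise M K m n (W m n)"
    and const: "1 \<le> C" "1 \<le> D" "0 < C0" "0 < D0" and h: "0 < h"
    and GC2: "\<exists>N. \<forall>(m, n)\<in>J. N \<le> m \<and> N \<le> n \<longrightarrow>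
                real m \<le> C0 * real n powr C \<and> real n \<le> D0 * real m powr D"
  shows "almost_surely M J (\<lambda>m n \<omega>. regular_noise K h a b (rb m n) (cb m n) m n (W m n \<omega>))"
proof -
  define \<kappa> where "\<kappa> = 1 / (2 * (K + K\<^sup>2)\<^sup>2)"
  have "0 < K + K\<^sup>2" using K by (simp add: add_pos_pos)
  then have \<kappa>: "0 < \<kappa>" by (simp add: \<kappa>_def)
  define Good where "Good m n \<omega> \<longleftrightarrow>
      (\<forall>k<m. \<forall>j<b. \<bar>\<Sum>l | l < n \<and> cb m n l = j. W m n \<omega> $$ (k, l)\<bar> \<le> n powr (1 / 2 + h)) \<and>
      (\<forall>l<n. \<forall>i<a. \<bar>\<Sum>k | k < m \<and> rb m n k = i. W m n \<omega> $$ (k, l)\<bar> \<le> m powr (1 / 2 + h)) \<and>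
      (\<forall>k<m. \<forall>k'<m. k \<noteq> k' \<longrightarrow>
         \<bar>\<Sum>l<n. W m n \<omega> $$ (k, l) * W m n \<omega> $$ (k', l)\<bar> \<le> n powr (1 / 2 + h))" for m n \<omega>
  have expo: "- (real x powr (1 / 2 + h))\<^sup>2 / (2 * (K + K\<^sup>2)\<^sup>2 * x) = - \<kappa> * x powr (2 * h)" if "0 < x" for x :: nat
  proof -
    have "(real x powr (1 / 2 + h))\<^sup>2 = x powr (1 + 2 * h)"
      using that by (simp add: power2_eq_square flip: powr_add)
    also have "\<dots> = x * x powr (2 * h)" using that by (simp add: powr_add)
    finally show ?thesis using that by (simp add: \<kappa>_def)
  qed
  \<comment> \<open>Packs the conclusion of \<open>wigner_noise_deviation\<close> into a predicate
    from which one exceptional event per size can be chosen.\<close>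
  define Bad where "Bad m n E \<longleftrightarrow> E \<in> events \<and>
      prob E \<le> 2 * (m * b + m * m) * exp (- \<kappa> * n powr (2 * h))
            + 2 * (n * a) * exp (- \<kappa> * m powr (2 * h)) \<and> (\<forall>\<omega>\<in>space M - E. Good m n \<omega>)" for m n E
  have ex: "\<exists>E. Bad m n E"
    if "(m, n) \<in> J" "1 \<le> m" "1 \<le> n" for m n
  proof -
    have W: "wigner_noise M K m n (W m n)" using noise that(1) by auto
    have mn: "0 < m" "0 < n" using that by auto
    show ?thesis
      using wigner_noise_deviation[OF W K powr_ge_zero powr_ge_zero, of b n "1 / 2 + h" a m "1 / 2 + h" "cb m n" "rb m n"]
      unfolding expo[OF mn(1)] expo[OF mn(2)] Good_def Bad_def Bex_def by simp
  qed
  define E where "E m n = (SOME E. Bad m n E)" for m n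
  have Bad: "Bad m n (E m n)" if "(m, n) \<in> J" "1 \<le> m" "1 \<le> n" for m n
    unfolding E_def by (rule someI_ex[OF ex[OF that]])
  obtain N0 where N0: "\<And>m n. (m, n) \<in> J \<Longrightarrow> N0 \<le> m \<Longrightarrow> N0 \<le> n \<Longrightarrow>
      real m \<le> C0 * real n powr C \<and> real n \<le> D0 * real m powr D"
    using GC2 by blast
  \<comment> \<open>Large enough that both counts of events, \<open>m * b + m * m\<close> and
    \<open>n * a\<close>, are at most \<open>s\<close> times the square of the dimension
    involved.\<close>
  define s where "s = real (a + b + 1)"
  obtain N1 where N1: "\<And>x. N1 \<le> x \<Longrightarrow>
      2 * s * (C0 * real x powr C) ^ 4 * real x ^ 2 * exp (- \<kappa> * real x powr (2 * h)) \<le> 1 / 2"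
    using eventually_poly_exp_small[OF \<kappa> h const(3,1), of "2 * s"]
    by (auto simp: eventually_sequentially s_def)
  obtain N2 where N2: "\<And>x. N2 \<le> x \<Longrightarrow>
      2 * s * (D0 * real x powr D) ^ 4 * real x ^ 2 * exp (- \<kappa> * real x powr (2 * h)) \<le> 1 / 2"
    using eventually_poly_exp_small[OF \<kappa> h const(4,2), of "2 * s"]
    by (auto simp: eventually_sequentially s_def)
  define N where "N = max 1 (max N0 (max N1 N2))"
  \<comment> \<open>Each of the two terms of the probability bound gets half of the target.
    \<open>x\<close> is the dimension in the polynomial factor, \<open>y\<close> the one in the
    exponential \<open>e\<close>, and \<open>u\<close> the GC2 bound on \<open>x\<close>. Of the
    fourth power of \<open>u\<close>, two factors come from the count \<open>q\<close> and two from
    the target.\<close>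
  have half: "2 * real q * e \<le> 1 / (2 * (real x ^ 2 * real y ^ 2))"
    if "1 \<le> x" "1 \<le> y" "real q \<le> s * real x ^ 2" "real x \<le> u" "2 * s * u ^ 4 * real y ^ 2 * e \<le> 1 / 2" "0 \<le> e"
    for q x y :: nat and u e :: real
  proof -
    have s0: "0 \<le> s" by (simp add: s_def)
    have "2 * real q * e * (real x ^ 2 * real y ^ 2) \<le> 2 * (s * real x ^ 2) * e * (real x ^ 2 * real y ^ 2)"
      using that by (intro mult_right_mono mult_left_mono) auto
    also have "\<dots> = 2 * s * real x ^ 4 * real y ^ 2 * e" by (simp add: power4_eq_xxxx power2_eq_square)
    also have "\<dots> \<le> 2 * s * u ^ 4 * real y ^ 2 * e"
      using that s0 by (intro mult_right_mono mult_left_mono power_mono) auto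
    also have "\<dots> \<le> 1 / 2" by fact
    finally show ?thesis using that by (simp add: field_simps)
  qed
  have Ele: "prob (E m n) \<le> 1 / (real m ^ 2 * real n ^ 2)" if "(m, n) \<in> J" "N \<le> m" "N \<le> n" for m n
  proof -
    have mn: "1 \<le> m" "1 \<le> n" "N0 \<le> m" "N0 \<le> n" "N1 \<le> n" "N2 \<le> m" using that by (auto simp: N_def)
    have sq: "real x \<le> real x ^ 2" if "1 \<le> x" for x :: nat
      using that by (simp add: power2_eq_square)
    have "real (m * b + m * m) \<le> s * real m ^ 2"
    proof -
      have "real m * real b \<le> real m ^ 2 * real b"
        using sq[OF mn(1)] by (rule mult_right_mono) simp
      moreover have "0 \<le> real m ^ 2 * real a" "0 \<le> real m ^ 2" by simp_all
      moreover have "s * real m ^ 2 = real m ^ 2 * real b + real m ^ 2 * real a + real m ^ 2"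
        by (simp add: s_def algebra_simps)
      moreover have "real (m * b + m * m) = real m * real b + real m ^ 2" by (simp add: power2_eq_square)
      ultimately show ?thesis by linarith
    qed
    then have 1: "2 * real (m * b + m * m) * exp (- \<kappa> * n powr (2 * h)) \<le> 1 / (2 * (real m ^ 2 * real n ^ 2))"
      using mn N0[OF that(1)] N1 by (intro half) auto
    have "real (n * a) \<le> s * real n ^ 2"
    proof -
      have "real n * real a \<le> real n ^ 2 * real a"
        using sq[OF mn(2)] by (rule mult_right_mono) simp
      moreover have "0 \<le> real n ^ 2 * real b" "0 \<le> real n ^ 2" by simp_all
      moreover have "s * real n ^ 2 = real n ^ 2 * real a + real n ^ 2 * real b + real n ^ 2"
        by (simp add: s_def algebra_simps)
      moreover have "real (n * a) = real n * real a" by (simp add: power2_eq_square)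
      ultimately show ?thesis by linarith
    qed
    then have 2: "2 * real (n * a) * exp (- \<kappa> * m powr (2 * h)) \<le> 1 / (2 * (real n ^ 2 * real m ^ 2))"
      using mn N0[OF that(1)] N2 by (intro half) auto
    have "prob (E m n) \<le> 2 * real (m * b + m * m) * exp (- \<kappa> * n powr (2 * h))
        + 2 * real (n * a) * exp (- \<kappa> * m powr (2 * h))"
      using Bad[OF that(1) mn(1,2)] by (simp add: Bad_def)
    also have "\<dots> \<le> 1 / (2 * (real m ^ 2 * real n ^ 2)) + 1 / (2 * (real n ^ 2 * real m ^ 2))"
      by (rule add_mono[OF 1 2])
    also have "\<dots> = 1 / (real m ^ 2 * real n ^ 2)" by (simp add: mult.commute)
    finally show ?thesis .
  qed
  have bc: "AE \<omega> in M. \<exists>m0 n0. \<forall>m\<ge>m0. \<forall>n\<ge>n0. (m, n) \<in> J \<longrightarrow> \<omega> \<notin> E m n"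
    using Ele Bad by (intro borel_cantelli_pairs[where N = N]) (auto simp: N_def Bad_def)
  \<comment> \<open>The entrywise bounds hold simultaneously because there are only countably many
    sizes and entries.\<close>
  have bd: "AE \<omega> in M. \<forall>m n k l. (m, n) \<in> J \<longrightarrow> k < m \<longrightarrow> l < n \<longrightarrow> \<bar>W m n \<omega> $$ (k, l)\<bar> \<le> K"
    using noise unfolding AE_all_countable by (fastforce simp: wigner_noise_def)
  show ?thesis unfolding almost_surely_def
    using bc bd AE_space
  proof eventually_elim
    case (elim \<omega>)
    then obtain m0 n0 where mn: "\<And>m n. m0 \<le> m \<Longrightarrow> n0 \<le> n \<Longrightarrow> (m, n) \<in> J \<Longrightarrow> \<omega> \<notin> E m n" by blast
    show ?case
    proof (intro exI[of _ "max 1 (max m0 n0)"] allI impI)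
      fix m n assume *: "max 1 (max m0 n0) \<le> m" "max 1 (max m0 n0) \<le> n" "(m, n) \<in> J"
      then have "Good m n \<omega>" using Bad[OF *(3)] mn elim(3) by (auto simp: Bad_def)
      moreover have "\<forall>k<m. \<forall>l<n. \<bar>W m n \<omega> $$ (k, l)\<bar> \<le> K" using elim(2) *(3) by blast
      ultimately show "regular_noise K h a b (rb m n) (cb m n) m n (W m n \<omega>)"
        unfolding Good_def regular_noise_def by blast
    qed
  qed
qed

section \<open>Rates, and constants of the pattern matrix\<close>

lemma eps_small:
  assumes "0 < \<sigma>" "0 < e"
  shows "\<exists>N. \<forall>m\<ge>N. \<forall>n\<ge>N. eps \<sigma> m n \<le> e"
proof -
  have "((\<lambda>x. real x powr - \<sigma>) \<longlongrightarrow> 0) sequentially" using assms by real_asymp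
  then have "eventually (\<lambda>x. real x powr - \<sigma> < e) sequentially" using assms by (intro order_tendstoD)
  then show ?thesis by (auto simp: eventually_sequentially eps_def intro: less_imp_le)
qed

text \<open>Each power in the maximum splits into two factors bounded by the respective maxima. This
  isolates the surplus decay that swallows constants in the main estimate.\<close>

lemma eps_mult_le:
  shows "eps (\<sigma> + \<tau>) m n \<le> eps \<sigma> m n * eps \<tau> m n"
proof -
  have "x powr - (\<sigma> + \<tau>) \<le> eps \<sigma> m n * eps \<tau> m n" if "x = real m \<or> x = real n" for x
  proof -
    have "x powr - (\<sigma> + \<tau>) = x powr - \<sigma> * x powr - \<tau>" using that by (auto simp flip: powr_add)
    also have "\<dots> \<le> eps \<sigma> m n * eps \<tau> m n"
      using that by (intro mult_mono) (auto simp: eps_def le_max_iff_disj)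
    finally show ?thesis .
  qed
  then show ?thesis by (simp add: eps_def[of "\<sigma> + \<tau>"])
qed

lemma eps_pos: "0 < m \<Longrightarrow> 0 < eps \<tau> m n"
  by (simp add: eps_def less_max_iff_disj)

lemma entry_bounds:
  fixes P :: "real mat"
  assumes P_nonneg: "\<forall>i<a. \<forall>j<b. 0 \<le> P $$ (i, j)"
    and P_row: "\<forall>i<a. \<exists>j<b. P $$ (i, j) \<noteq> 0"
    and P_col: "\<forall>j<b. \<exists>i<a. P $$ (i, j) \<noteq> 0"
  obtains p \<pi> where "0 \<le> p" "0 < \<pi>" "\<And>i j. i < a \<Longrightarrow> j < b \<Longrightarrow> \<bar>P $$ (i, j)\<bar> \<le> p"
    "\<And>i. i < a \<Longrightarrow> \<exists>j<b. \<pi> \<le> P $$ (i, j)" "\<And>j. j < b \<Longrightarrow> \<exists>i<a. \<pi> \<le> P $$ (i, j)"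
proof
  define S where "S = (\<lambda>(i, j). P $$ (i, j)) ` ({..<a} \<times> {..<b})"
  \<comment> \<open>The inserted values 0 and 1 keep the maximum and minimum defined if there are no
    entries, or no positive ones.\<close>
  define p where "p = Max (insert 0 S)"
  define \<pi> where "\<pi> = Min (insert 1 {x\<in>S. 0 < x})"
  have S: "finite S" by (simp add: S_def)
  have mem: "P $$ (i, j) \<in> S" if "i < a" "j < b" for i j using that by (auto simp: S_def)
  show "0 \<le> p" using S by (simp add: p_def)
  show "0 < \<pi>" using S by (auto simp: \<pi>_def)
  show "\<bar>P $$ (i, j)\<bar> \<le> p" if "i < a" "j < b" for i j
    using P_nonneg that S mem[OF that] by (simp add: p_def)
  have le: "\<pi> \<le> P $$ (i, j)" if "i < a" "j < b" "P $$ (i, j) \<noteq> 0" for i j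
    using P_nonneg that S mem[OF that(1,2)] unfolding \<pi>_def by (intro Min_le) (auto simp: order_le_less)
  show "\<exists>j<b. \<pi> \<le> P $$ (i, j)" if "i < a" for i using P_row le that by blast
  show "\<exists>i<a. \<pi> \<le> P $$ (i, j)" if "j < b" for j using P_col le that by blast
qed

text \<open>By nonnegativity the sum is at least that over block \<open>j\<close> alone, which has
  at least \<open>d * n\<close> indices. With GC1 and the absence of zero rows and columns in the
  pattern this gives row and column sums of full order.\<close>

lemma block_sum_ge:
  fixes f :: "nat \<Rightarrow> real"
  assumes sz: "(\<Sum>j<b. sz j) = n" and nn: "\<And>j. j < b \<Longrightarrow> 0 \<le> f j"
    and j: "j < b" "\<pi> \<le> f j" "d \<le> real (sz j) / real n" and n: "0 < n" and pos: "0 \<le> \<pi>"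
  shows "\<pi> * d * n \<le> (\<Sum>l<n. f (block_of sz l))"
proof -
  have "\<pi> * d * n = \<pi> * (d * n)" by simp
  also have "\<dots> \<le> f j * sz j"
    using j n pos nn[OF j(1)]
    by (intro order_trans[OF mult_left_mono[of _ "real (sz j)"] mult_right_mono]) (auto simp: pos_le_divide_eq)
  also have "\<dots> = (\<Sum>l | l < n \<and> block_of sz l = j. f (block_of sz l))"
    using card_block[OF j(1) sz] by (simp add: mult.commute)
  also have "\<dots> \<le> (\<Sum>l<n. f (block_of sz l))"
    using nn block_of_less[of _ sz b] sz by (intro sum_mono2) auto
  finally show ?thesis .
qed

section \<open>Weighted variances of noisy matrices\<close>

theorem theorem18:
  fixes M :: "'w measure"
    and P :: "real mat"
    and a b r :: nat
    and J :: "(nat \<times> nat) set"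
    and ms ns :: "nat \<Rightarrow> nat \<Rightarrow> nat \<Rightarrow> nat"
    and W A :: "nat \<Rightarrow> nat \<Rightarrow> 'w \<Rightarrow> real mat"
    and K c d C D C0 D0 \<delta> \<tau> :: real
  assumes prob: "prob_space M"
    and P_dim: "P \<in> carrier_mat a b"
    and P_rank: "vec_space.rank a P = r"
    and P_nonneg: "\<forall>i<a. \<forall>j<b. 0 \<le> P $$ (i, j)"
    and P_row: "\<forall>i<a. \<exists>j<b. P $$ (i, j) \<noteq> 0"
    and P_col: "\<forall>j<b. \<exists>i<a. P $$ (i, j) \<noteq> 0"
    and ms: "\<forall>(m, n)\<in>J. (\<forall>i<a. 0 < ms m n i) \<and> (\<Sum>i<a. ms m n i) = m"
    and ns: "\<forall>(m, n)\<in>J. (\<forall>j<b. 0 < ns m n j) \<and> (\<Sum>j<b. ns m n j) = n"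
    and irred: "\<forall>(m, n)\<in>J. irreducible_mat (blow_up P (ms m n) (ns m n) m n)"
    and K_pos: "0 < K"
    and noise: "\<forall>(m, n)\<in>J. wigner_noise M K m n (W m n)"
    and A: "\<forall>(m, n)\<in>J. \<forall>\<omega>\<in>space M. A m n \<omega> = blow_up P (ms m n) (ns m n) m n + W m n \<omega>"
    and GC1_const: "0 < c" "c < 1" "0 < d" "d < 1"
    and GC1: "\<forall>(m, n)\<in>J. (\<forall>i<a. c \<le> real (ms m n i) / real m) \<and>
                          (\<forall>j<b. d \<le> real (ns m n j) / real n)"
    and GC2_const: "1 \<le> C" "1 \<le> D" "0 < C0" "0 < D0"
    and GC2: "\<exists>N. \<forall>(m, n)\<in>J. N \<le> m \<and> N \<le> n \<longrightarrow>
                real m \<le> C0 * real n powr C \<and> real n \<le> D0 * real m powr D"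
    and \<delta>_pos: "0 < \<delta>"
    and \<delta>: "\<forall>\<tau>'. 0 < \<tau>' \<and> \<tau>' < 1 / 2 \<longrightarrow>
              almost_surely M J (\<lambda>m n \<omega>. singular_value_gap (corr (A m n \<omega>)) r \<delta> (eps \<tau>' m n))"
    and \<tau>: "0 < \<tau>" "\<tau> < 1 / 2"
  shows "almost_surely M J (\<lambda>m n \<omega>.
           \<forall>ys xs. top_singular_vectors (corr (A m n \<omega>)) r ys xs \<longrightarrow>
             weighted_variance (row_sum (A m n \<omega>)) a (Y_corr (A m n \<omega>) ys)
               \<le> real r / (\<delta> / eps \<tau> m n - 1)\<^sup>2 \<and>
             weighted_variance (col_sum (A m n \<omega>)) b (X_corr (A m n \<omega>) xs)
               \<le> real r / (\<delta> / eps \<tau> m n - 1)\<^sup>2)"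
proof -

  \<comment> \<open>Constants and thresholds\<close>
  interpret prob_space M by (rule prob)
  obtain p \<pi> where p: "0 \<le> p" and \<pi>: "0 < \<pi>"
    and P_bound: "\<And>i j. i < a \<Longrightarrow> j < b \<Longrightarrow> \<bar>P $$ (i, j)\<bar> \<le> p"
    and P_row_ge: "\<And>i. i < a \<Longrightarrow> \<exists>j<b. \<pi> \<le> P $$ (i, j)"
    and P_col_ge: "\<And>j. j < b \<Longrightarrow> \<exists>i<a. \<pi> \<le> P $$ (i, j)"
    using entry_bounds[OF P_nonneg P_row P_col] by blast
  \<comment> \<open>Half of the lower bound from \<open>block_sum_ge\<close>, serving rows and
    columns at once.\<close>
  define g where "g = \<pi> * min c d / 2"
  have g: "0 < g" using \<pi> GC1_const by (simp add: g_def)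
  \<comment> \<open>Once \<open>eps \<tau> m n \<le> \<delta> / 2\<close>, the lower end
    \<open>\<delta> - eps \<tau> m n\<close> of the singular value interval is at least
    this.\<close>
  define \<zeta> where "\<zeta> = \<delta> / 2"
  have \<zeta>: "0 < \<zeta>" using \<delta>_pos by (simp add: \<zeta>_def)
  \<comment> \<open>Chosen so that \<open>1 / 2 - h = \<tau> + h\<close>: the noise level still
    decays faster than \<open>eps \<tau>\<close>, by a factor \<open>eps h\<close>.\<close>
  define h where "h = (1 / 2 - \<tau>) / 2"
  have h: "0 < h" "h < 1 / 2" using \<tau> by (auto simp: h_def)
  define Q where "Q = (p + g) * (2 * ((a + b) * p / (g\<^sup>2 * sqrt g) * (1 + 1 / \<zeta>) / \<zeta>))\<^sup>2"
  have Q: "0 \<le> Q" unfolding Q_def using p g by simp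
  \<comment> \<open>Dividing \<open>n powr (1 / 2 + h)\<close> by \<open>n\<close> gives the
    exponent \<open>- (1 / 2 - h)\<close>.\<close>
  define \<theta> where "\<theta> m n = eps (1 / 2 - h) m n" for m n
  \<comment> \<open>The Gram bound \<open>K\<^sup>2 * n + n powr (1 / 2 + h) * m\<close> divided by
    \<open>m * n\<close> is at most the expression under the root.\<close>
  define \<kappa> where "\<kappa> m n = sqrt (K\<^sup>2 * eps 1 m n + \<theta> m n)" for m n
  have \<theta>_le: "\<theta> m n \<le> eps h m n * eps \<tau> m n" for m n
  proof -
    have "1 / 2 - h = h + \<tau>" unfolding h_def by (simp add: field_simps)
    then show ?thesis unfolding \<theta>_def using eps_mult_le by metis
  qed
  \<comment> \<open>\<open>e1\<close> ensures \<open>(a + b) * \<theta> \<le> g\<close>.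
    \<open>e2\<close> bounds each of the two summands of the square of \<open>\<kappa>\<close>,
    giving \<open>\<kappa> / g \<le> \<zeta> / 2\<close>. \<open>e3\<close> makes
    \<open>eps h\<close> absorb the constant \<open>Q\<close>. The added 1 in \<open>e1\<close> and
    \<open>e3\<close> keeps the denominators positive.\<close>
  define e1 where "e1 = g / (a + b + 1)"
  define e2 where "e2 = (g * \<zeta> / 2)\<^sup>2 / 2"
  define e3 where "e3 = 1 / ((sqrt Q + 1) * \<delta>)"
  have e: "0 < e1" "0 < e2" "0 < e2 / K\<^sup>2" "0 < e3" "0 < \<delta> / 2"
    using g \<zeta> K_pos \<delta>_pos Q by (auto simp: e1_def e2_def e3_def intro!: divide_pos_pos mult_pos_pos add_nonneg_pos)
  have h': "0 < 1 / 2 - h" using h by simp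
  obtain N1 where N1: "\<And>m n. N1 \<le> m \<Longrightarrow> N1 \<le> n \<Longrightarrow> \<theta> m n \<le> e1"
    using eps_small[OF h' e(1)] unfolding \<theta>_def by blast
  obtain N2 where N2: "\<And>m n. N2 \<le> m \<Longrightarrow> N2 \<le> n \<Longrightarrow> \<theta> m n \<le> e2"
    using eps_small[OF h' e(2)] unfolding \<theta>_def by blast
  have "\<exists>N. \<forall>m\<ge>N. \<forall>n\<ge>N. eps 1 m n \<le> e2 / K\<^sup>2"
    by (rule eps_small[OF _ e(3)]) simp
  then obtain N3 where N3: "\<And>m n. N3 \<le> m \<Longrightarrow> N3 \<le> n \<Longrightarrow> eps 1 m n \<le> e2 / K\<^sup>2"
    by blast
  obtain N4 where N4: "\<And>m n. N4 \<le> m \<Longrightarrow> N4 \<le> n \<Longrightarrow> eps h m n \<le> e3"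
    using eps_small[OF h(1) e(4)] by blast
  obtain N5 where N5: "\<And>m n. N5 \<le> m \<Longrightarrow> N5 \<le> n \<Longrightarrow> eps \<tau> m n \<le> \<delta> / 2"
    using eps_small[OF \<tau>(1) e(5)] by blast
  \<comment> \<open>The summand 1 makes both dimensions positive, and \<open>r\<close> makes the
    list of singular values long enough.\<close>
  define N where "N = 1 + r + N1 + N2 + N3 + N4 + N5"
  have N: "1 \<le> N" "r \<le> N" "N1 \<le> N" "N2 \<le> N" "N3 \<le> N" "N4 \<le> N" "N5 \<le> N"
    by (simp_all add: N_def)

  \<comment> \<open>The bound for one regular realization\<close>
  have main: "weighted_variance (row_sum (A m n \<omega>)) a (Y_corr (A m n \<omega>) ys) \<le> real r / (\<delta> / eps \<tau> m n - 1)\<^sup>2 \<and>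
      weighted_variance (col_sum (A m n \<omega>)) b (X_corr (A m n \<omega>) xs) \<le> real r / (\<delta> / eps \<tau> m n - 1)\<^sup>2"
    if J: "(m, n) \<in> J" and mn: "N \<le> m" "N \<le> n" and \<omega>: "\<omega> \<in> space M"
      and reg: "regular_noise K h a b (block_of (ms m n)) (block_of (ns m n)) m n (W m n \<omega>)"
      and gap: "singular_value_gap (corr (A m n \<omega>)) r \<delta> (eps \<tau> m n)"
      and top: "top_singular_vectors (corr (A m n \<omega>)) r ys xs"
    for m n \<omega> ys xs
  proof -
    have W_bound: "\<forall>k<m. \<forall>l<n. \<bar>W m n \<omega> $$ (k, l)\<bar> \<le> K"
      and W_row: "\<forall>k<m. \<forall>j<b. \<bar>\<Sum>l | l < n \<and> block_of (ns m n) l = j. W m n \<omega> $$ (k, l)\<bar> \<le> n powr (1 / 2 + h)"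
      and W_col: "\<forall>l<n. \<forall>i<a. \<bar>\<Sum>k | k < m \<and> block_of (ms m n) k = i. W m n \<omega> $$ (k, l)\<bar> \<le> m powr (1 / 2 + h)"
      and W_gram: "\<forall>k<m. \<forall>k'<m. k \<noteq> k' \<longrightarrow> \<bar>\<Sum>l<n. W m n \<omega> $$ (k, l) * W m n \<omega> $$ (k', l)\<bar> \<le> n powr (1 / 2 + h)"
      using reg unfolding regular_noise_def by blast+
    let ?rb = "block_of (ms m n)" and ?cb = "block_of (ns m n)"
    have m: "0 < m" and n: "0 < n" using mn N by linarith+
    have msum: "(\<Sum>i<a. ms m n i) = m" and mpos: "\<And>i. i < a \<Longrightarrow> 0 < ms m n i" using ms J by auto
    have nsum: "(\<Sum>j<b. ns m n j) = n" and npos: "\<And>j. j < b \<Longrightarrow> 0 < ns m n j" using ns J by auto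
    have ms_ge: "\<And>i. i < a \<Longrightarrow> c \<le> real (ms m n i) / real m"
      and ns_ge: "\<And>j. j < b \<Longrightarrow> d \<le> real (ns m n j) / real n" using GC1 J by auto
    have rb: "?rb k < a" if "k < m" for k using block_of_less[of k "ms m n" a] that msum by simp
    have cb: "?cb l < b" if "l < n" for l using block_of_less[of l "ns m n" b] that nsum by simp
    have \<theta>0: "0 \<le> \<theta> m n" unfolding \<theta>_def using eps_pos[OF m] less_imp_le by blast
    have e10: "0 \<le> eps 1 m n" using eps_pos[OF m] less_imp_le by blast
    have powr_le: "real x powr (1 / 2 + h) \<le> \<theta> m n * x" if "x = m \<or> x = n" for x
    proof -
      have "real x powr (1 / 2 + h) = real x powr (1 + - (1 / 2 - h))" by simp
      also have "\<dots> = x * real x powr - (1 / 2 - h)" using that m n by (subst powr_add) auto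
      also have "\<dots> \<le> x * \<theta> m n"
        using that by (intro mult_left_mono) (auto simp: \<theta>_def eps_def)
      finally show ?thesis by (simp add: mult.commute)
    qed
    have \<kappa>_sq: "(\<kappa> m n)\<^sup>2 = K\<^sup>2 * eps 1 m n + \<theta> m n" using \<theta>0 e10 by (simp add: \<kappa>_def)
    have \<kappa>0: "0 \<le> \<kappa> m n" using \<theta>0 e10 by (simp add: \<kappa>_def)
    have W_op': "(\<Sum>l<n. (\<Sum>k<m. W m n \<omega> $$ (k, l) * u k)\<^sup>2) \<le> (\<kappa> m n)\<^sup>2 * (m * n) * (\<Sum>k<m. (u k)\<^sup>2)" for u
    proof -
      have "(\<Sum>l<n. (\<Sum>k<m. W m n \<omega> $$ (k, l) * u k)\<^sup>2)
          \<le> (K\<^sup>2 * n + n powr (1 / 2 + h) * m) * (\<Sum>k<m. (u k)\<^sup>2)"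
        using W_bound W_gram by (intro gram_operator_bound) auto
      also have "\<dots> \<le> (\<kappa> m n)\<^sup>2 * (m * n) * (\<Sum>k<m. (u k)\<^sup>2)"
      proof (rule mult_right_mono)
        have "real m powr - 1 \<le> eps 1 m n" by (simp add: eps_def)
        then have "1 \<le> eps 1 m n * m" using m by (simp add: powr_minus field_simps)
        then have "K\<^sup>2 * n * 1 \<le> K\<^sup>2 * n * (eps 1 m n * m)" by (intro mult_left_mono) auto
        moreover have "n powr (1 / 2 + h) * m \<le> \<theta> m n * n * m"
          using powr_le by (intro mult_right_mono) auto
        ultimately show "K\<^sup>2 * n + n powr (1 / 2 + h) * m \<le> (\<kappa> m n)\<^sup>2 * (m * n)"
          by (simp add: \<kappa>_sq algebra_simps)
      qed (simp add: sum_nonneg)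
      finally show ?thesis .
    qed
    have row_lower: "2 * g * n \<le> (\<Sum>l<n. P $$ (i, ?cb l))" if i: "i < a" for i
    proof -
      obtain j where j: "j < b" "\<pi> \<le> P $$ (i, j)" using P_row_ge[OF i] by blast
      have "2 * g * n \<le> \<pi> * d * n" using \<pi> by (simp add: g_def mult_right_mono)
      also have "\<dots> \<le> (\<Sum>l<n. P $$ (i, ?cb l))"
        by (rule block_sum_ge[where f = "\<lambda>j. P $$ (i, j)", OF nsum _ j ns_ge[OF j(1)] n])
          (use P_nonneg i \<pi> in auto)
      finally show ?thesis .
    qed
    have col_lower: "2 * g * m \<le> (\<Sum>k<m. P $$ (?rb k, j))" if j: "j < b" for j
    proof -
      obtain i where i: "i < a" "\<pi> \<le> P $$ (i, j)" using P_col_ge[OF j] by blast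
      have "2 * g * m \<le> \<pi> * c * m" using \<pi> by (simp add: g_def mult_right_mono)
      also have "\<dots> \<le> (\<Sum>k<m. P $$ (?rb k, j))"
        by (rule block_sum_ge[where f = "\<lambda>i. P $$ (i, j)", OF msum _ i ms_ge[OF i(1)] m])
          (use P_nonneg j \<pi> in auto)
      finally show ?thesis .
    qed
    have \<theta>1: "\<theta> m n \<le> e1" and \<theta>2: "\<theta> m n \<le> e2" and ep1: "eps 1 m n \<le> e2 / K\<^sup>2"
      and ep2: "eps h m n \<le> e3" and ep3: "eps \<tau> m n \<le> \<delta> / 2"
      using N1 N2 N3 N4 N5 mn N by auto
    have \<theta>_small: "(a + b) * \<theta> m n \<le> g"
    proof -
      have "(a + b) * \<theta> m n \<le> (a + b + 1) * e1" using \<theta>1 \<theta>0 by (intro mult_mono) auto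
      then show ?thesis by (simp add: e1_def)
    qed
    interpret block_perturbation m n a b ?rb ?cb "\<lambda>i j. P $$ (i, j)" "\<lambda>k l. W m n \<omega> $$ (k, l)"
      p g "\<theta> m n" "\<kappa> m n"
    proof (rule block_perturbation.intro)
      show "\<bar>\<Sum>l | l < n \<and> ?cb l = j. W m n \<omega> $$ (k, l)\<bar> \<le> \<theta> m n * n" if "k < m" "j < b" for k j
        using W_row that by (intro order_trans[OF _ powr_le]) auto
      show "\<bar>\<Sum>k | k < m \<and> ?rb k = i. W m n \<omega> $$ (k, l)\<bar> \<le> \<theta> m n * m" if "l < n" "i < a" for l i
        using W_col that by (intro order_trans[OF _ powr_le]) auto
      show "(\<Sum>k<m. (\<Sum>l<n. W m n \<omega> $$ (k, l) * v l)\<^sup>2) \<le> (\<kappa> m n)\<^sup>2 * (m * n) * (\<Sum>l<n. (v l)\<^sup>2)" for v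
        by (rule operator_bound_transpose[OF _ W_op']) simp
    qed (rule m n rb cb P_bound row_lower[OF rb] col_lower[OF cb] g \<theta>0 \<kappa>0 p W_op' \<theta>_small; assumption?)+
    have \<kappa>_small: "\<kappa> m n / g \<le> \<zeta> / 2"
    proof -
      have "K\<^sup>2 * eps 1 m n \<le> e2" using ep1 K_pos by (simp add: field_simps)
      then have "(\<kappa> m n)\<^sup>2 \<le> (g * \<zeta> / 2)\<^sup>2" using \<theta>2 by (simp add: \<kappa>_sq e2_def)
      then have "\<kappa> m n \<le> g * \<zeta> / 2" by (rule power2_le_imp_le) (use g \<zeta> in simp)
      then show ?thesis using g by (simp add: field_simps)
    qed
    have W_car: "W m n \<omega> \<in> carrier_mat m n" using noise J \<omega> by (auto simp: wigner_noise_def)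
    have A_eq: "A m n \<omega> = blow_up P (ms m n) (ns m n) m n + W m n \<omega>" using A J \<omega> by auto
    have A_car: "A m n \<omega> \<in> carrier_mat m n" using W_car by (simp add: A_eq blow_up_def)
    have A_entry: "A m n \<omega> $$ (k, l) = entry k l"
      if "k < m" "l < n" for k l
      using W_car that by (simp add: A_eq blow_up_def entry_def)
    have surj: "\<exists>k<x. block_of sz k = i" if "i < y" "(\<Sum>i<y. sz i) = x" "0 < sz i" for i x y sz
      using card_block[OF that(1,2)] that(3) by (metis (mono_tags, lifting) card_gt_0_iff empty_Collect_eq)
    have corr_dim: "dim_row (corr (A m n \<omega>)) = m" "dim_col (corr (A m n \<omega>)) = n"
      using A_car by (simp_all add: corr_def inv_sqrt_Drow_def inv_sqrt_Dcol_def mat_diag_def)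
    \<comment> \<open>The dimensions are at least \<open>r\<close>, so index \<open>i\<close> lies
      within the list and the gap property applies.\<close>
    have z: "\<zeta> \<le> singular_values (corr (A m n \<omega>)) ! i" if "i < r" for i
    proof -
      have "i < length (singular_values (corr (A m n \<omega>)))"
        using that mn N by (simp add: length_singular_values corr_dim)
      then have "\<delta> - eps \<tau> m n \<le> singular_values (corr (A m n \<omega>)) ! i"
        using gap that by (auto simp: singular_value_gap_def)
      then show ?thesis using ep3 by (simp add: \<zeta>_def)
    qed
    have var: "weighted_variance (row_sum (A m n \<omega>)) a (Y_corr (A m n \<omega>) ys) \<le> r * (Q * (\<theta> m n)\<^sup>2)"
      "weighted_variance (col_sum (A m n \<omega>)) b (X_corr (A m n \<omega>) xs) \<le> r * (Q * (\<theta> m n)\<^sup>2)"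
      unfolding Q_def
      by (rule weighted_variance_corr_le[OF A_car A_entry surj[OF _ msum mpos] surj[OF _ nsum npos] \<zeta> \<kappa>_small z top]; assumption)+
    have eps0: "0 < eps \<tau> m n" by (rule eps_pos[OF m])
    have "sqrt Q * \<theta> m n \<le> eps \<tau> m n / \<delta>"
    proof -
      have "\<theta> m n \<le> e3 * eps \<tau> m n"
        using \<theta>_le[of m n] mult_right_mono[OF ep2, of "eps \<tau> m n"] eps0 by linarith
      then have "sqrt Q * \<theta> m n \<le> (sqrt Q + 1) * (e3 * eps \<tau> m n)"
        using Q \<theta>0 by (intro mult_mono) auto
      also have "\<dots> = eps \<tau> m n / \<delta>"
        using Q \<delta>_pos by (simp add: e3_def add_nonneg_eq_0_iff)
      finally show ?thesis .
    qed
    \<comment> \<open>From \<open>eps \<tau> m n \<le> \<delta> / 2\<close> the denominator is at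
      least 1, hence positive, and it is smaller than
      \<open>\<delta> / eps \<tau> m n\<close>.\<close>
    also have "\<dots> \<le> 1 / (\<delta> / eps \<tau> m n - 1)"
      using ep3 eps0 \<delta>_pos by (simp add: field_simps)
    finally have "(sqrt Q * \<theta> m n)\<^sup>2 \<le> (1 / (\<delta> / eps \<tau> m n - 1))\<^sup>2"
      using Q \<theta>0 by (intro power_mono) auto
    then have "Q * (\<theta> m n)\<^sup>2 \<le> 1 / (\<delta> / eps \<tau> m n - 1)\<^sup>2"
      using Q by (simp add: power_mult_distrib power_divide)
    then have "r * (Q * (\<theta> m n)\<^sup>2) \<le> r * (1 / (\<delta> / eps \<tau> m n - 1)\<^sup>2)"
      by (intro mult_left_mono) auto
    with var show ?thesis by simp
  qed

  \<comment> \<open>Passage to the almost sure statement\<close>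
  have noise_as: "almost_surely M J (\<lambda>m n \<omega>.
      regular_noise K h a b (block_of (ms m n)) (block_of (ns m n)) m n (W m n \<omega>))"
    by (rule wigner_noise_almost_surely[where rb = "\<lambda>m n. block_of (ms m n)" and cb = "\<lambda>m n. block_of (ns m n)",
          OF K_pos noise GC2_const h(1) GC2])
  \<comment> \<open>The singular value gap is needed only at the exponent \<open>\<tau>\<close>
    itself; the faster rate comes from the noise bounds.\<close>
  have gap_as: "almost_surely M J (\<lambda>m n \<omega>. singular_value_gap (corr (A m n \<omega>)) r \<delta> (eps \<tau> m n))"
    using \<delta> \<tau> by blast
  show ?thesis
    unfolding almost_surely_def
    using noise_as[unfolded almost_surely_def] gap_as[unfolded almost_surely_def] AE_space
  proof eventually_elim
    case (elim \<omega>)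
    from elim(1) obtain m1 n1 where 1: "\<forall>m\<ge>m1. \<forall>n\<ge>n1. (m, n) \<in> J \<longrightarrow>
      regular_noise K h a b (block_of (ms m n)) (block_of (ns m n)) m n (W m n \<omega>)"
      by blast
    from elim(2) obtain m2 n2 where 2: "\<forall>m\<ge>m2. \<forall>n\<ge>n2. (m, n) \<in> J \<longrightarrow>
      singular_value_gap (corr (A m n \<omega>)) r \<delta> (eps \<tau> m n)" by blast
    show ?case
    proof (intro exI[of _ "max N (max (max m1 m2) (max n1 n2))"] allI impI)
      fix m n ys xs
      assume *: "max N (max (max m1 m2) (max n1 n2)) \<le> m" "max N (max (max m1 m2) (max n1 n2)) \<le> n" "(m, n) \<in> J"
        and top: "top_singular_vectors (corr (A m n \<omega>)) r ys xs"
      show "weighted_variance (row_sum (A m n \<omega>)) a (Y_corr (A m n \<omega>) ys) \<le> real r / (\<delta> / eps \<tau> m n - 1)\<^sup>2 \<and>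
        weighted_variance (col_sum (A m n \<omega>)) b (X_corr (A m n \<omega>) xs) \<le> real r / (\<delta> / eps \<tau> m n - 1)\<^sup>2"
      proof (rule main[OF *(3) _ _ elim(3) _ _ top])
        show "N \<le> m" "N \<le> n" using *(1,2) by simp_all
        show "regular_noise K h a b (block_of (ms m n)) (block_of (ns m n)) m n (W m n \<omega>)"
          using 1 * by simp
        show "singular_value_gap (corr (A m n \<omega>)) r \<delta> (eps \<tau> m n)" using 2 * by simp
      qed
    qed
  qed
qed

end
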